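(* Let $Q\subset\mathbb{R}^2$ be a convex polygon and $K\subset\mathbb{R}^2$ a convex shape. If every $Q$-normal triangle fits into $K$, then every closed curve of unit $Q$-length fits into $K$. Consequently, every $Q$-normal triangle fits into $K$ if and only if $c(K\times Q)\ge 1$.
   Context: A convex shape is a compact convex subset of $\mathbb{R}^2$ with non-empty interior. For $x\in\mathbb{R}^2$ let $\|x\|_Q=\max_{y\in Q}\langle x,y\rangle$. The $Q$-length of a closed polygonal curve $v_1\to\dots\to v_m\to v_1$ is $\sum_i \|v_{i+1}-v_i\|_Q$ (indices mod $m$); for rectifiable closed curves it is defined by polygonal approximation. The $Q$-length of closed curves is unchanged if $Q$ is translated, so one may assume $Q$ contains the origin in its interior. A set $A$ fits into $B$ if $A+t\subset B$ for some $t\in\mathbb{R}^2$. A non-degenerate triangle is $Q$-normal if its boundary can be oriented $u\to v\to w\to u$ so that the directions of $v-u$, $w-v$, $u-w$ are outward normal directions of sides of $Q$ and $\|v-u\|_Q+\|w-v\|_Q+\|u-w\|_Q=1$. A segment $[u,v]$ (a degenerate triangle) is $Q$-normal if the directions of $v-u$ and $u-v$ are outward normal directions of sides of $Q$ and $\|v-u\|_Q+\|u-v\|_Q=1$. "$Q$-normal triangles" includes both kinds. $c(K\times Q)$ is the Ekeland--Hofer--Zehnder capacity of the lagrangian product $K\times Q\subset\mathbb{R}^2\times\mathbb{R}^2$, i.e. the minimal action of a closed generalized characteristic on $\partial(K\times Q)$; equivalently the minimal $Q$-length of a closed generalized $Q$-Minkowski billiard orbit in $K$. *)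

theory Defs
  imports "HOL-Analysis.Analysis"
begin

type_synonym R2 = "real^2"
type_synonym R4 = "(real^2) \<times> (real^2)"

definition convex_shape :: "R2 set \<Rightarrow> bool" where
  "convex_shape K \<longleftrightarrow> compact K \<and> convex K \<and> interior K \<noteq> {}"

definition convex_polygon :: "R2 set \<Rightarrow> bool" where
  "convex_polygon Q \<longleftrightarrow> (\<exists>S. finite S \<and> Q = convex hull S) \<and> interior Q \<noteq> {}"

definition qnorm :: "R2 set \<Rightarrow> R2 \<Rightarrow> real" where
  "qnorm Q x = Sup ((\<lambda>y. inner x y) ` Q)"

definition fits :: "R2 set \<Rightarrow> R2 set \<Rightarrow> bool" where
  "fits A B \<longleftrightarrow> (\<exists>t. (\<lambda>x. x + t) ` A \<subseteq> B)"

definition side_of :: "R2 set \<Rightarrow> R2 set \<Rightarrow> bool" where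
  "side_of S Q \<longleftrightarrow> S face_of Q \<and> aff_dim S = 1"

definition outward_normal_dir :: "R2 set \<Rightarrow> R2 \<Rightarrow> bool" where
  "outward_normal_dir Q d \<longleftrightarrow> d \<noteq> 0 \<and>
     (\<exists>S. side_of S Q \<and> (\<forall>y\<in>S. inner d y = qnorm Q d))"

definition Q_normal_triangle :: "R2 set \<Rightarrow> R2 set \<Rightarrow> bool" where
  "Q_normal_triangle Q T \<longleftrightarrow>
     (\<exists>u v w. \<not> collinear {u, v, w} \<and> T = convex hull {u, v, w} \<and>
        outward_normal_dir Q (v - u) \<and> outward_normal_dir Q (w - v) \<and>
        outward_normal_dir Q (u - w) \<and>
        qnorm Q (v - u) + qnorm Q (w - v) + qnorm Q (u - w) = 1)
   \<or> (\<exists>u v. u \<noteq> v \<and> T = closed_segment u v \<and>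
        outward_normal_dir Q (v - u) \<and> outward_normal_dir Q (u - v) \<and>
        qnorm Q (v - u) + qnorm Q (u - v) = 1)"

definition closed_poly_qlength :: "R2 set \<Rightarrow> R2 list \<Rightarrow> real" where
  "closed_poly_qlength Q ps =
     (\<Sum>i<length ps. qnorm Q (ps ! (Suc i mod length ps) - ps ! i))"

definition closed_curve :: "(real \<Rightarrow> R2) \<Rightarrow> bool" where
  "closed_curve \<gamma> \<longleftrightarrow> continuous_on {0..1} \<gamma> \<and> \<gamma> 0 = \<gamma> 1"

definition inscribed_qlengths :: "R2 set \<Rightarrow> (real \<Rightarrow> R2) \<Rightarrow> real set" where
  "inscribed_qlengths Q \<gamma> =
     {closed_poly_qlength Q (map \<gamma> ts) | ts. ts \<noteq> [] \<and> sorted ts \<and> set ts \<subseteq> {0..1}}"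

definition unit_qlength :: "R2 set \<Rightarrow> (real \<Rightarrow> R2) \<Rightarrow> bool" where
  "unit_qlength Q \<gamma> \<longleftrightarrow> bdd_above (inscribed_qlengths Q \<gamma>) \<and> Sup (inscribed_qlengths Q \<gamma>) = 1"

text \<open>Symplectic structure on \<open>R^2_q \<times> R^2_p\<close>.\<close>
definition Jsymp :: "R4 \<Rightarrow> R4" where
  "Jsymp z = (snd z, - fst z)"

definition normal_cone :: "R4 set \<Rightarrow> R4 \<Rightarrow> R4 set" where
  "normal_cone C x = {v. \<forall>y\<in>C. inner v (y - x) \<le> 0}"

text \<open>Closed generalized characteristic on the boundary of a convex body \<open>C\<close>:
  an absolutely continuous loop \<open>z\<close> on [0,T] with derivative \<open>z'\<close> (a.e.) in
  \<open>J N_C(z)\<close>, non-constant.\<close>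
definition closed_gen_char :: "R4 set \<Rightarrow> real \<Rightarrow> (real \<Rightarrow> R4) \<Rightarrow> (real \<Rightarrow> R4) \<Rightarrow> bool" where
  "closed_gen_char C T z z' \<longleftrightarrow> T > 0 \<and>
     z' absolutely_integrable_on {0..T} \<and>
     (\<forall>t\<in>{0..T}. z t = z 0 + integral {0..t} z') \<and>
     (\<exists>N. negligible N \<and> (\<forall>t\<in>{0..T} - N. z' t \<in> Jsymp ` normal_cone C (z t))) \<and>
     (\<forall>t\<in>{0..T}. z t \<in> frontier C) \<and> z T = z 0 \<and>
     (\<exists>t\<in>{0..T}. z t \<noteq> z 0)"

definition action :: "real \<Rightarrow> (real \<Rightarrow> R4) \<Rightarrow> (real \<Rightarrow> R4) \<Rightarrow> real" where
  "action T z z' = (1/2) * integral {0..T} (\<lambda>t. inner (- Jsymp (z' t)) (z t))"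

definition EHZ_capacity :: "R4 set \<Rightarrow> real" where
  "EHZ_capacity C = Inf {action T z z' | T z z'. closed_gen_char C T z z'}"

end

theory Submission
  imports Defs
begin

text \<open>
  Every vector is a nonnegative combination of outward side normals of \<open>Q\<close> on which the
  \<open>Q\<close>-norm is additive, so a closed polygon may be refined to one all of whose edges are
  side normals.  By Caratheodory's theorem the edge coefficients of such a polygon are a sum of
  circuits, each supported on two opposite or three positively dependent normals; circuits are
  scaled \<open>Q\<close>-normal triangles.  The vertices are therefore sums of points of \<open>l\<^sub>i K\<close>, up to
  translation, with \<open>l\<^sub>i\<close> the lengths of the circuits, and convexity of \<open>K\<close> makes the polygon
  fit.  Compactness passes from inscribed polygons to curves.

  The action of a closed characteristic \<open>(q, p)\<close> is the \<open>Q\<close>-length of \<open>q\<close>.  Were it below 1,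
  some translate of \<open>q\<close> would keep a positive distance from the boundary of \<open>K\<close>; testing the
  normal cone condition against this translate makes \<open>p\<close>, and then \<open>q\<close>, constant.  Conversely,
  take a shortest closed triangle that does not fit into the interior of \<open>K\<close>.  It fits into
  \<open>K\<close>, separation produces normals of \<open>K\<close> at its vertices summing to 0, and minimality produces
  points of \<open>Q\<close> whose differences are these normals: together they form a closed
  characteristic whose action is the length of the triangle.
\<close>

section \<open>The support function of a polygon\<close>

text \<open>\<open>Q\<close> need not contain the origin, so \<open>qnorm Q\<close> may be negative
  on single vectors. Estimates are therefore made relative to the centre of a ball inside
  \<open>Q\<close>; the linear terms that this introduces cancel around closed loops.

  Triangles suffice because a minimal positive dependency in the plane has at most three members,
  and three-point loops are all that the converse has to consider. There the obstacle is that a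
  \<open>Q\<close>-normal triangle outside \<open>K\<close> need not lie on a characteristic. It
  serves only as a competitor: the minimum is taken over all triples of points, which leaves enough
  freedom for a multiplier argument. "Not fitting" is measured against the interior of
  \<open>K\<close>, since this is a closed condition and so admits a minimiser.

  The link with \<open>Q\<close> is that the length of a triple is itself a support function, namely
  that of the set of cyclic differences of three points of \<open>Q\<close>. A linear functional
  dominated by the length therefore is such a difference triple, and its components are at once
  normals of \<open>K\<close> and jumps of the momentum.\<close>

lemma inner_le_qnorm:
  assumes "compact Q" "y \<in> Q"
  shows "x \<bullet> y \<le> qnorm Q x"
proof -
  have "compact ((\<lambda>y. x \<bullet> y) ` Q)"
    by (intro compact_continuous_image continuous_intros assms)
  then have "bdd_above ((\<lambda>y. x \<bullet> y) ` Q)"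
    by (simp add: bounded_imp_bdd_above compact_imp_bounded)
  then show ?thesis
    unfolding qnorm_def using assms by (intro cSup_upper) auto
qed

lemma qnorm_attained:
  assumes "compact Q" "Q \<noteq> {}"
  obtains y where "y \<in> Q" "qnorm Q x = x \<bullet> y"
proof -
  have "continuous_on Q (\<lambda>y. x \<bullet> y)"
    by (intro continuous_intros)
  then obtain y where y: "y \<in> Q" "\<forall>z\<in>Q. x \<bullet> z \<le> x \<bullet> y"
    using continuous_attains_sup assms by blast
  then have "qnorm Q x = x \<bullet> y"
    unfolding qnorm_def by (intro cSup_eq_maximum) auto
  with y that show thesis by blast
qed

lemma qnorm_le:
  assumes "Q \<noteq> {}" "\<And>y. y \<in> Q \<Longrightarrow> x \<bullet> y \<le> c"
  shows "qnorm Q x \<le> c"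
  unfolding qnorm_def using assms by (intro cSup_least) auto

lemma qnorm_eqI:
  assumes "y \<in> Q" "\<And>z. z \<in> Q \<Longrightarrow> x \<bullet> z \<le> x \<bullet> y"
  shows "qnorm Q x = x \<bullet> y"
  unfolding qnorm_def using assms by (intro cSup_eq_maximum) auto

lemma qnorm_add:
  assumes "compact Q" "Q \<noteq> {}"
  shows "qnorm Q (x + y) \<le> qnorm Q x + qnorm Q y"
  using assms by (intro qnorm_le) (auto simp: inner_add_left intro!: add_mono inner_le_qnorm)

lemma qnorm_scaleR:
  assumes "compact Q" "Q \<noteq> {}" "0 \<le> c"
  shows "qnorm Q (c *\<^sub>R x) = c * qnorm Q x"
proof -
  obtain y where y: "y \<in> Q" "qnorm Q x = x \<bullet> y"
    using qnorm_attained assms by blast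
  have "qnorm Q (c *\<^sub>R x) = (c *\<^sub>R x) \<bullet> y"
    by (rule qnorm_eqI)
      (use y assms inner_le_qnorm[OF assms(1)] in \<open>auto intro!: mult_left_mono simp flip: y(2)\<close>)
  then show ?thesis using y by simp
qed

lemma qnorm_0: "Q \<noteq> {} \<Longrightarrow> qnorm Q 0 = 0"
  unfolding qnorm_def by simp

text \<open>Tested at \<open>y\<close> moved by \<open>r\<close> in the direction of
  \<open>x\<close>. The term \<open>x \<bullet> y\<close> stays because \<open>y\<close> need not be
  the origin; it disappears when edges of a closed loop are added.\<close>

lemma qnorm_ge_cball:
  assumes "compact Q" "cball y r \<subseteq> Q" "0 \<le> r"
  shows "x \<bullet> y + r * norm x \<le> qnorm Q x"
proof -
  let ?y = "y + (r / norm x) *\<^sub>R x"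
  have "?y \<in> cball y r" using assms by (simp add: dist_norm)
  then have "x \<bullet> ?y \<le> qnorm Q x" using assms inner_le_qnorm by blast
  moreover have "x \<bullet> ?y = x \<bullet> y + r * norm x"
    by (cases "x = 0") (auto simp: inner_add_right dot_square_norm power2_eq_square)
  ultimately show ?thesis by simp
qed

lemma convex_polygonD:
  assumes "convex_polygon Q"
  shows "polytope Q" "compact Q" "convex Q" "Q \<noteq> {}" "interior Q \<noteq> {}"
proof -
  show p: "polytope Q" "interior Q \<noteq> {}"
    using assms unfolding convex_polygon_def polytope_def by auto
  then show "compact Q" "convex Q" "Q \<noteq> {}"
    by (auto simp: polytope_imp_compact polytope_imp_convex)
qed

lemma interior_cballE:
  fixes S :: "'a::euclidean_space set"
  assumes "interior S \<noteq> {}"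
  obtains y r where "0 < r" "cball y r \<subseteq> S"
proof -
  obtain y where "y \<in> interior S" using assms by auto
  then show thesis
    using that by (meson mem_interior_cball)
qed

lemma outward_normal_dir_scaleR:
  assumes "compact Q" "Q \<noteq> {}" "0 < c" "outward_normal_dir Q d"
  shows "outward_normal_dir Q (c *\<^sub>R d)"
proof -
  obtain S where S: "side_of S Q" "\<forall>y\<in>S. d \<bullet> y = qnorm Q d" "d \<noteq> 0"
    using assms(4) unfolding outward_normal_dir_def by blast
  then have "\<forall>y\<in>S. (c *\<^sub>R d) \<bullet> y = qnorm Q (c *\<^sub>R d)"
    using assms by (simp add: qnorm_scaleR)
  then show ?thesis
    using S assms(3) unfolding outward_normal_dir_def by (metis less_irrefl scaleR_eq_0_iff)
qed

text \<open>Normalise the facet inequalities \<open>a \<bullet> y \<le> b\<close> of \<open>Q\<close> at an interior point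
  \<open>y\<^sub>0\<close>, so that they read \<open>\<nu> \<bullet> (y - y\<^sub>0) \<le> 1\<close>.  The polar of \<open>Q - y\<^sub>0\<close> is then
  the convex hull of \<open>0\<close> and the vectors \<open>\<nu>\<close>.\<close>

lemma polygon_normals:
  assumes Q: "convex_polygon Q"
  obtains N where "finite N" "\<And>v. v \<in> N \<Longrightarrow> outward_normal_dir Q v"
    "\<And>x. \<exists>c. (\<forall>v\<in>N. 0 \<le> c v) \<and> x = (\<Sum>v\<in>N. c v *\<^sub>R v) \<and>
        (\<Sum>v\<in>N. c v * qnorm Q v) \<le> qnorm Q x"
proof -
  note Qp = convex_polygonD[OF Q]
  obtain y0 r where r: "0 < r" "cball y0 r \<subseteq> Q"
    using interior_cballE Qp(5) by blast
  have y0: "y0 \<in> Q" using r by auto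
  have aff: "affine hull Q = UNIV"
    using Qp(5) affine_hull_nonempty_interior by blast
  have "polyhedron Q" using Qp(1) polytope_imp_polyhedron by blast
  then obtain F where F: "finite F" "Q = (affine hull Q) \<inter> \<Inter>F"
      "\<forall>h \<in> F. \<exists>a b. a \<noteq> 0 \<and> h = {x. a \<bullet> x \<le> b}"
      "\<forall>F'. F' \<subset> F \<longrightarrow> Q \<subset> (affine hull Q) \<inter> \<Inter>F'"
    unfolding polyhedron_Int_affine_minimal by blast
  from F(3) obtain a b where ab: "\<And>h. h \<in> F \<Longrightarrow> a h \<noteq> 0 \<and> h = {x. a h \<bullet> x \<le> b h}"
    by metis
  have QF: "y \<in> Q \<longleftrightarrow> (\<forall>h\<in>F. a h \<bullet> y \<le> b h)" for y
  proof -
    have "y \<in> Q \<longleftrightarrow> (\<forall>h\<in>F. y \<in> h)" using F(2) aff by auto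
    also have "\<dots> \<longleftrightarrow> (\<forall>h\<in>F. a h \<bullet> y \<le> b h)" using ab by blast
    finally show ?thesis .
  qed
  \<comment> \<open>Minimality of \<open>F\<close> makes each of its inequalities cut out a facet,
    and a facet of a two-dimensional set has dimension 1.\<close>
  have side: "side_of (Q \<inter> {x. a h \<bullet> x = b h}) Q" if "h \<in> F" for h
  proof -
    have "(Q \<inter> {x. a h \<bullet> x = b h}) facet_of Q"
      by (subst facet_of_polyhedron_explicit[OF F(1) F(2) ab]) (use F(4) that in auto)
    moreover have "aff_dim Q = 2"
      using aff_dim_nonempty_interior[OF Qp(5)] by simp
    ultimately show ?thesis
      unfolding side_of_def facet_of_def by auto
  qed
  have qa: "qnorm Q (a h) = b h" and od: "outward_normal_dir Q (a h)" if "h \<in> F" for h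
  proof -
    have "Q \<inter> {x. a h \<bullet> x = b h} \<noteq> {}"
      using side[OF that] unfolding side_of_def by (metis aff_dim_empty_eq aff_dim_empty one_neq_neg_one)
    then obtain y where "y \<in> Q" "a h \<bullet> y = b h" by auto
    then show 1: "qnorm Q (a h) = b h"
      using qnorm_eqI[of y Q "a h"] QF that by auto
    then show "outward_normal_dir Q (a h)"
      unfolding outward_normal_dir_def using ab[OF that] side[OF that] by fastforce
  qed
  define k where "k h = b h - a h \<bullet> y0" for h
  have k: "0 < k h" if "h \<in> F" for h
  proof -
    have "a h \<bullet> y0 + r * norm (a h) \<le> b h"
      using qnorm_ge_cball[OF Qp(2) r(2), of "a h"] r(1) qa[OF that] by simp
    moreover have "0 < r * norm (a h)" using r ab[OF that] by simp
    ultimately show ?thesis unfolding k_def by simp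
  qed
  define N where "N = (\<lambda>h. (1 / k h) *\<^sub>R a h) ` F"
  have finN: "finite N" unfolding N_def using F by simp
  have outN: "outward_normal_dir Q v" if "v \<in> N" for v
    using that od k outward_normal_dir_scaleR[OF Qp(2,4)] unfolding N_def by fastforce
  have qN: "qnorm Q v = 1 + v \<bullet> y0" if vN: "v \<in> N" for v
  proof -
    obtain h where h: "h \<in> F" "v = (1 / k h) *\<^sub>R a h" using vN unfolding N_def by blast
    then have "qnorm Q v = b h / k h" using qnorm_scaleR[OF Qp(2,4), of "1 / k h" "a h"] k[of h] qa by simp
    also have "\<dots> = 1 + v \<bullet> y0" using h k[OF h(1)] by (simp add: field_simps k_def)
    finally show ?thesis .
  qed
  have QN: "y \<in> Q" if "\<And>v. v \<in> N \<Longrightarrow> v \<bullet> (y - y0) \<le> 1" for y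
    unfolding QF
  proof
    fix h assume h: "h \<in> F"
    then have "((1 / k h) *\<^sub>R a h) \<bullet> (y - y0) \<le> 1" using that unfolding N_def by blast
    then have "a h \<bullet> (y - y0) \<le> k h" using k[OF h] by (simp add: field_simps)
    then show "a h \<bullet> y \<le> b h" unfolding k_def by (simp add: inner_diff_right)
  qed
  \<comment> \<open>Bipolar argument: \<open>0\<close> lies in the hull, so a strict separation has
    \<open>\<beta> < 0\<close>, and division by \<open>\<beta>\<close> reverses inequalities. The
    resulting \<open>y\<close> obeys every facet inequality but violates the bound on
    \<open>x\<close>.\<close>
  have polar: "x \<in> convex hull (insert 0 N)" if x: "qnorm Q x \<le> 1 + x \<bullet> y0" for x
  proof (rule ccontr)
    assume "x \<notin> convex hull (insert 0 N)"
    moreover have "closed (convex hull (insert 0 N))"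
      using finN by (simp add: compact_imp_closed finite_imp_compact_convex_hull)
    ultimately obtain v \<beta> where v: "v \<bullet> x < \<beta>" "\<forall>z\<in>convex hull (insert 0 N). v \<bullet> z > \<beta>"
      using separating_hyperplane_closed_point[of "convex hull (insert 0 N)" x] by auto
    have b0: "\<beta> < 0" using v(2) hull_inc[of 0 "insert 0 N" convex] by force
    define y where "y = y0 + (1 / \<beta>) *\<^sub>R v"
    have "y \<in> Q"
    proof (rule QN)
      fix u assume "u \<in> N"
      then have "v \<bullet> u > \<beta>" using v(2) hull_inc[of u "insert 0 N" convex] by auto
      then show "u \<bullet> (y - y0) \<le> 1" using b0 by (simp add: y_def inner_commute field_simps)
    qed
    then have "x \<bullet> y \<le> 1 + x \<bullet> y0" using inner_le_qnorm[OF Qp(2), of y x] x by simp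
    then have "x \<bullet> v / \<beta> \<le> 1" by (simp add: y_def inner_add_right)
    then show False using v(1) b0 by (simp add: field_simps inner_commute)
  qed
  show thesis
  proof (rule that[OF finN outN])
    fix x :: R2
    show "\<exists>c. (\<forall>v\<in>N. 0 \<le> c v) \<and> x = (\<Sum>v\<in>N. c v *\<^sub>R v) \<and>
        (\<Sum>v\<in>N. c v * qnorm Q v) \<le> qnorm Q x"
    proof (cases "x = 0")
      case True
      then show ?thesis by (intro exI[of _ "\<lambda>_. 0"]) (simp add: qnorm_0 Qp)
    next
      case False
      \<comment> \<open>The support function of \<open>Q\<close> translated by \<open>- y0\<close>;
        dividing \<open>x\<close> by it lands in the polar set.\<close>
      define \<kappa> where "\<kappa> = qnorm Q x - x \<bullet> y0"
      have "0 < r * norm x" using r False by simp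
      then have \<kappa>: "0 < \<kappa>"
        using qnorm_ge_cball[OF Qp(2) r(2), of x] r(1) unfolding \<kappa>_def by simp
      have "qnorm Q ((1 / \<kappa>) *\<^sub>R x) = 1 + ((1 / \<kappa>) *\<^sub>R x) \<bullet> y0"
        using \<kappa> by (simp add: qnorm_scaleR Qp field_simps \<kappa>_def)
      then have "(1 / \<kappa>) *\<^sub>R x \<in> convex hull (insert 0 N)" by (intro polar) simp
      then obtain u where u: "\<forall>v\<in>insert 0 N. 0 \<le> u v" "sum u (insert 0 N) = 1"
          "(\<Sum>v\<in>insert 0 N. u v *\<^sub>R v) = (1 / \<kappa>) *\<^sub>R x"
        using finN by (auto simp: convex_hull_finite)
      \<comment> \<open>The weight that the hull gives to \<open>0\<close> is discarded, so only an
        inequality remains.\<close>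
      have u1: "sum u N \<le> 1"
        using u(1,2) finN by (metis finite_insert insertI1 subset_insertI sum_mono2 DiffD1)
      have n0: "0 \<notin> N" using outN unfolding outward_normal_dir_def by blast
      have u3: "(\<Sum>v\<in>N. u v *\<^sub>R v) = (1 / \<kappa>) *\<^sub>R x"
        using u(3) finN n0 by simp
      have x: "x = (\<Sum>v\<in>N. (\<kappa> * u v) *\<^sub>R v)"
        using arg_cong[OF u3, of "\<lambda>z. \<kappa> *\<^sub>R z"] \<kappa> by (simp add: scaleR_sum_right)
      have "(\<Sum>v\<in>N. \<kappa> * u v * qnorm Q v) = (\<Sum>v\<in>N. \<kappa> * u v * (1 + v \<bullet> y0))"
        using qN by simp
      also have "\<dots> = \<kappa> * sum u N + (\<Sum>v\<in>N. (\<kappa> * u v) *\<^sub>R v) \<bullet> y0"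
        by (simp add: inner_sum_left sum_distrib_left sum.distrib algebra_simps)
      also have "\<dots> \<le> \<kappa> + x \<bullet> y0" using u1 \<kappa> x by (simp add: mult_left_le)
      also have "\<dots> = qnorm Q x" unfolding \<kappa>_def by simp
      finally show ?thesis
        using x u(1) \<kappa> by (intro exI[of _ "\<lambda>v. \<kappa> * u v"]) auto
    qed
  qed
qed

section \<open>Decomposition of positive dependencies\<close>

text \<open>The dependency places \<open>0\<close> in the convex hull of the vectors, and in the
  plane three of them already suffice. A vanishing coefficient would leave an opposite pair or a
  zero vector, both excluded.\<close>

lemma positive_circuit_exists:
  fixes \<nu> :: "'j \<Rightarrow> R2"
  assumes S: "finite S" "S \<noteq> {}" and \<nu>: "\<And>j. j \<in> S \<Longrightarrow> \<nu> j \<noteq> 0"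
    and a: "\<And>j. j \<in> S \<Longrightarrow> 0 < a j" and sum0: "(\<Sum>j\<in>S. a j *\<^sub>R \<nu> j) = 0"
    and nopair: "\<And>i j b c. \<lbrakk>i \<in> S; j \<in> S; 0 < b; 0 < c\<rbrakk> \<Longrightarrow> b *\<^sub>R \<nu> i + c *\<^sub>R \<nu> j \<noteq> 0"
  obtains i j k b c d where "i \<in> S" "j \<in> S" "k \<in> S" "0 < b" "0 < c" "0 < d"
    "b *\<^sub>R \<nu> i + c *\<^sub>R \<nu> j + d *\<^sub>R \<nu> k = 0"
proof -
  define A where "A = sum a S"
  have A: "0 < A" unfolding A_def using S a by (intro sum_pos) auto
  have "(\<Sum>j\<in>S. (a j / A) *\<^sub>R \<nu> j) \<in> convex hull (\<nu> ` S)"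
  proof (rule convex_sum[OF S(1) convex_convex_hull])
    show "(\<Sum>j\<in>S. a j / A) = 1" using A by (simp add: A_def flip: sum_divide_distrib)
    show "0 \<le> a j / A" if "j \<in> S" for j using a[OF that] A by simp
    show "\<nu> j \<in> convex hull (\<nu> ` S)" if "j \<in> S" for j using that by (simp add: hull_inc)
  qed
  moreover have "(\<Sum>j\<in>S. (a j / A) *\<^sub>R \<nu> j) = (1 / A) *\<^sub>R (\<Sum>j\<in>S. a j *\<^sub>R \<nu> j)"
    by (simp add: scaleR_sum_right)
  ultimately have "0 \<in> convex hull (\<nu> ` S)" using sum0 by simp
  then obtain s where s: "finite s" "s \<subseteq> \<nu> ` S" "card s \<le> 3" "0 \<in> convex hull s"
    using caratheodory[of "\<nu> ` S"] by auto
  have "s \<noteq> {}" using s(4) by auto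
  then have "card s = 1 \<or> card s = 2 \<or> card s = 3"
    using s(1,3) by (auto simp: le_Suc_eq numeral_3_eq_3)
  then have "\<exists>x y z. s = {x, y, z}"
    by (metis card_1_singletonE card_2_iff card_3_iff insert_absorb2)
  then obtain x y z where xyz: "s = {x, y, z}" by blast
  then obtain i j k where ijk: "i \<in> S" "j \<in> S" "k \<in> S" "x = \<nu> i" "y = \<nu> j" "z = \<nu> k"
    using s(2) unfolding xyz by (auto simp: image_iff)
  obtain b c d where bcd: "0 \<le> b" "0 \<le> c" "0 \<le> d" "b + c + d = 1"
      "b *\<^sub>R \<nu> i + c *\<^sub>R \<nu> j + d *\<^sub>R \<nu> k = 0"
    using s(4) unfolding xyz ijk(4-6) convex_hull_3 by fastforce
  have np: "p = 0 \<and> q = 0" if "0 \<le> p" "0 \<le> q" "p *\<^sub>R \<nu> l + q *\<^sub>R \<nu> m = 0" "l \<in> S" "m \<in> S" for p q l m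
    using nopair[of l m p q] that \<nu>[of l] \<nu>[of m]
    by (cases "p = 0"; cases "q = 0") auto
  have "b \<noteq> 0" using np[of c d j k] bcd ijk by auto
  moreover have "c \<noteq> 0" using np[of b d i k] bcd ijk by auto
  moreover have "d \<noteq> 0" using np[of b c i j] bcd ijk by auto
  ultimately show thesis
    using that[of i j k b c d] ijk bcd by force
qed

text \<open>\<open>\<theta>\<close> is the largest multiple of \<open>b\<close> that can be
  subtracted from \<open>a\<close>: the least ratio \<open>a j / b j\<close>. An index attaining it
  leaves the support.\<close>

lemma positive_dependency_reduce:
  fixes a b :: "'j \<Rightarrow> real"
  assumes J: "finite J" and b: "\<And>j. 0 \<le> b j" and ab: "\<And>j. 0 < b j \<Longrightarrow> j \<in> J \<and> 0 < a j"
    and k: "0 < b k" and a: "\<And>j. 0 \<le> a j"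
  obtains \<theta> where "0 < \<theta>" "\<And>j. 0 \<le> a j - \<theta> * b j"
    "card {j\<in>J. 0 < a j - \<theta> * b j} < card {j\<in>J. 0 < a j}"
proof -
  define B where "B = {j\<in>J. 0 < b j}"
  have B: "finite B" "B \<noteq> {}" unfolding B_def using J k ab by auto
  define \<theta> where "\<theta> = Min ((\<lambda>j. a j / b j) ` B)"
  have "\<theta> \<in> (\<lambda>j. a j / b j) ` B" unfolding \<theta>_def using B by (intro Min_in) auto
  then obtain m where m: "m \<in> B" "\<theta> = a m / b m" by auto
  have le: "\<theta> \<le> a j / b j" if "j \<in> B" for j
    unfolding \<theta>_def using B that by (intro Min_le) auto
  have pos: "0 < \<theta>" using m ab unfolding B_def by auto
  have ge: "0 \<le> a j - \<theta> * b j" for j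
  proof (cases "j \<in> B")
    case True
    then show ?thesis using le[OF True] unfolding B_def by (simp add: field_simps)
  next
    case False
    then have "b j = 0" using ab[of j] b[of j] unfolding B_def by force
    then show ?thesis using a by simp
  qed
  have "{j\<in>J. 0 < a j - \<theta> * b j} \<subseteq> {j\<in>J. 0 < a j}"
  proof safe
    fix j assume "0 < a j - \<theta> * b j"
    moreover have "0 \<le> \<theta> * b j" using pos b by simp
    ultimately show "0 < a j" by linarith
  qed
  moreover have "m \<in> {j\<in>J. 0 < a j} - {j\<in>J. 0 < a j - \<theta> * b j}"
    using m ab unfolding B_def by auto
  ultimately have "card {j\<in>J. 0 < a j - \<theta> * b j} < card {j\<in>J. 0 < a j}"
    using J by (intro psubset_card_mono) auto
  with pos ge that show thesis by blast
qed

text \<open>On a line, \<open>y\<close> and \<open>z\<close> are multiples of \<open>x\<close> by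
  \<open>k - 1\<close> and \<open>- k\<close>, and one of these factors is negative. Degenerate
  triples thus reduce to opposite pairs.\<close>

lemma collinear_dependent_triangle:
  fixes x y z :: R2
  assumes "collinear {0, x, x + y}" "x + y + z = 0" "x \<noteq> 0" "y \<noteq> 0" "z \<noteq> 0"
  shows "\<exists>c>0. x + c *\<^sub>R y = 0 \<or> x + c *\<^sub>R z = 0"
proof -
  from assms(1,3) have "x + y = 0 \<or> (\<exists>k. x + y = k *\<^sub>R x)"
    by (auto simp: collinear_lemma)
  then obtain k where "x + y = k *\<^sub>R x" by (metis scale_zero_left)
  then have y: "y = (k - 1) *\<^sub>R x" by (simp add: algebra_simps)
  have z: "z = (- k) *\<^sub>R x" using assms(2) \<open>x + y = k *\<^sub>R x\<close> by (metis add_eq_0_iff scaleR_minus_left)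
  show ?thesis
  proof (cases "k < 1")
    case True
    then have "(k - 1) / (1 - k) = - 1" by (simp add: divide_eq_eq)
    then have "x + (1 / (1 - k)) *\<^sub>R y = 0" unfolding y by simp
    then show ?thesis using True by (intro exI[of _ "1 / (1 - k)"]) simp
  next
    case False
    then have "x + (1 / k) *\<^sub>R z = 0" unfolding z by simp
    then show ?thesis using False by (intro exI[of _ "1 / k"]) simp
  qed
qed

text \<open>The entries are added rather than chosen by cases, so coinciding indices need no special
  treatment and sums over \<open>J\<close> split termwise.\<close>

definition circuit2 :: "'j \<Rightarrow> 'j \<Rightarrow> real \<Rightarrow> real \<Rightarrow> 'j \<Rightarrow> real" where
  "circuit2 i j b c = (\<lambda>l. (if l = i then b else 0) + (if l = j then c else 0))"

definition circuit3 :: "'j \<Rightarrow> 'j \<Rightarrow> 'j \<Rightarrow> real \<Rightarrow> real \<Rightarrow> real \<Rightarrow> 'j \<Rightarrow> real" where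
  "circuit3 i j k b c d = (\<lambda>l. (if l = i then b else 0) + (if l = j then c else 0) + (if l = k then d else 0))"

text \<open>Subtracting a maximal multiple of a circuit shrinks the support. A pair is preferred
  whenever the support contains one, which is why every triple met is non-collinear. The conditions
  on \<open>r\<close> record the order in which a chain meets the edges of the circuit.\<close>

lemma positive_dependency_induct:
  fixes \<nu> :: "'j \<Rightarrow> R2" and r :: "'j \<Rightarrow> nat"
  assumes J: "finite J" and \<nu>: "\<And>j. j \<in> J \<Longrightarrow> \<nu> j \<noteq> 0"
    and a: "\<And>j. 0 \<le> a j" "\<And>j. j \<notin> J \<Longrightarrow> a j = 0" "(\<Sum>j\<in>J. a j *\<^sub>R \<nu> j) = 0"
    and zero: "G (\<lambda>_. 0)"
    and add: "\<And>b c. G b \<Longrightarrow> G c \<Longrightarrow> G (\<lambda>j. b j + c j)"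
    and pair: "\<And>i j b c. \<lbrakk>i \<in> J; j \<in> J; r i \<le> r j; 0 < b; 0 < c; b *\<^sub>R \<nu> i + c *\<^sub>R \<nu> j = 0\<rbrakk>
      \<Longrightarrow> G (circuit2 i j b c)"
    and triple: "\<And>i j k b c d. \<lbrakk>i \<in> J; j \<in> J; k \<in> J; r i \<le> r j; r j \<le> r k; 0 < b; 0 < c; 0 < d;
        b *\<^sub>R \<nu> i + c *\<^sub>R \<nu> j + d *\<^sub>R \<nu> k = 0; \<not> collinear {0, b *\<^sub>R \<nu> i, b *\<^sub>R \<nu> i + c *\<^sub>R \<nu> j}\<rbrakk>
      \<Longrightarrow> G (circuit3 i j k b c d)"
  shows "G a"
  using a
proof (induction "card {j\<in>J. 0 < a j}" arbitrary: a rule: less_induct)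
  case less
  define S where "S = {j\<in>J. 0 < a j}"
  have S: "finite S" "S \<subseteq> J" unfolding S_def using J by auto
  have out: "a j = 0" if "j \<notin> S" for j
    using that less.prems(1)[of j] less.prems(2)[of j] unfolding S_def by force
  \<comment> \<open>The multiple of \<open>b\<close> to subtract is dictated by \<open>a\<close>, so
    \<open>G\<close> is asked of all positive multiples of \<open>b\<close>.\<close>
  have step: "G a" if b: "\<And>j. 0 \<le> b j" "\<And>j. 0 < b j \<Longrightarrow> j \<in> S" "0 < b k"
      "(\<Sum>j\<in>J. b j *\<^sub>R \<nu> j) = 0" "\<And>\<theta>. 0 < \<theta> \<Longrightarrow> G (\<lambda>j. \<theta> * b j)" for b k
  proof -
    obtain \<theta> where \<theta>: "0 < \<theta>" "\<And>j. 0 \<le> a j - \<theta> * b j"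
        "card {j\<in>J. 0 < a j - \<theta> * b j} < card {j\<in>J. 0 < a j}"
      using positive_dependency_reduce[OF J, of b a k] b less.prems(1) unfolding S_def by blast
    have "b j = 0" if "j \<notin> J" for j
      using b(1)[of j] b(2)[of j] S that by force
    then have "G (\<lambda>j. a j - \<theta> * b j)"
      using \<theta> less.prems b(4)
      by (intro less.hyps) (auto simp: sum_subtractf algebra_simps simp flip: scaleR_scaleR scaleR_sum_right)
    then show "G a" using add[OF _ b(5)[OF \<theta>(1)]] by force
  qed
  show "G a"
  proof (cases "S = {}")
    case True
    then have "a = (\<lambda>_. 0)" using out by blast
    then show ?thesis using zero by simp
  next
    case False
    show ?thesis
    proof (cases "\<exists>i j b c. i \<in> S \<and> j \<in> S \<and> 0 < b \<and> 0 < c \<and> b *\<^sub>R \<nu> i + c *\<^sub>R \<nu> j = 0")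
      case True
      then obtain i j b c where p: "i \<in> S" "j \<in> S" "0 < b" "0 < c" "b *\<^sub>R \<nu> i + c *\<^sub>R \<nu> j = 0" "r i \<le> r j"
        by (metis add.commute linear)
      show ?thesis
      proof (rule step[of "circuit2 i j b c" i])
        show "(\<Sum>l\<in>J. circuit2 i j b c l *\<^sub>R \<nu> l) = 0"
          using p S by (auto simp: circuit2_def scaleR_add_left sum.distrib if_distrib[of "\<lambda>t. t *\<^sub>R _"] J cong: if_cong)
        fix \<theta> :: real assume \<theta>: "0 < \<theta>"
        have "(\<lambda>l. \<theta> * circuit2 i j b c l) = circuit2 i j (\<theta> * b) (\<theta> * c)"
          by (auto simp: circuit2_def algebra_simps)
        moreover have z: "(\<theta> * b) *\<^sub>R \<nu> i + (\<theta> * c) *\<^sub>R \<nu> j = 0"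
          using arg_cong[OF p(5), of "\<lambda>x. \<theta> *\<^sub>R x"] by (simp add: scaleR_add_right)
        have "G (circuit2 i j (\<theta> * b) (\<theta> * c))"
          by (rule pair[OF _ _ p(6) _ _ z]) (use p(1-4) S \<theta> in auto)
        ultimately show "G (\<lambda>l. \<theta> * circuit2 i j b c l)" by simp
      qed (use p(1-4) in \<open>auto simp: circuit2_def split: if_splits\<close>)
    next
      case nopair: False
      obtain i j k b c d where t: "i \<in> S" "j \<in> S" "k \<in> S" "0 < b" "0 < c" "0 < d"
          "b *\<^sub>R \<nu> i + c *\<^sub>R \<nu> j + d *\<^sub>R \<nu> k = 0"
      proof (rule positive_circuit_exists[OF S(1) False, of \<nu> a])
        have "(\<Sum>j\<in>S. a j *\<^sub>R \<nu> j) = (\<Sum>j\<in>J. a j *\<^sub>R \<nu> j)"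
          using S out J by (intro sum.mono_neutral_left) auto
        then show "(\<Sum>j\<in>S. a j *\<^sub>R \<nu> j) = 0" using less.prems(3) by simp
        show "\<nu> j \<noteq> 0" if "j \<in> S" for j using \<nu> S that by blast
        show "0 < a j" if "j \<in> S" for j using that unfolding S_def by blast
        show "b *\<^sub>R \<nu> i + c *\<^sub>R \<nu> j \<noteq> 0" if "i \<in> S" "j \<in> S" "0 < b" "0 < c" for i j b c
          using nopair that by blast
      qed
      \<comment> \<open>The coefficients are hidden under the existential so that they travel with
        their indices; adjacent swaps then sort the triple by rank.\<close>
      define R where "R i j k \<longleftrightarrow> (\<exists>b c d. i \<in> S \<and> j \<in> S \<and> k \<in> S \<and> 0 < b \<and> 0 < c \<and> 0 < d \<and>
        b *\<^sub>R \<nu> i + c *\<^sub>R \<nu> j + d *\<^sub>R \<nu> k = 0)" for i j k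
      have R1: "R j i k" if Rijk: "R i j k" for i j k
      proof -
        obtain b c d where h: "i \<in> S" "j \<in> S" "k \<in> S" "0 < b" "0 < c" "0 < d"
            "b *\<^sub>R \<nu> i + c *\<^sub>R \<nu> j + d *\<^sub>R \<nu> k = 0"
          using Rijk unfolding R_def by blast
        have "c *\<^sub>R \<nu> j + b *\<^sub>R \<nu> i + d *\<^sub>R \<nu> k = 0" using h(7) by (simp only: add_ac)
        with h(1-6) show ?thesis unfolding R_def by blast
      qed
      have R2: "R i k j" if Rijk: "R i j k" for i j k
      proof -
        obtain b c d where h: "i \<in> S" "j \<in> S" "k \<in> S" "0 < b" "0 < c" "0 < d"
            "b *\<^sub>R \<nu> i + c *\<^sub>R \<nu> j + d *\<^sub>R \<nu> k = 0"
          using Rijk unfolding R_def by blast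
        have "b *\<^sub>R \<nu> i + d *\<^sub>R \<nu> k + c *\<^sub>R \<nu> j = 0" using h(7) by (simp only: add_ac)
        with h(1-6) show ?thesis unfolding R_def by blast
      qed
      have "R i j k" unfolding R_def using t by blast
      then have "\<exists>i j k. R i j k \<and> r i \<le> r j \<and> r j \<le> r k"
        using R1[of i j k] R2[of i j k] R1[of i k j] R2[of j i k] R2[of k i j] R1[of j k i]
        by (cases "r i \<le> r j"; cases "r j \<le> r k"; cases "r i \<le> r k") force+
      then obtain i j k b c d where t: "i \<in> S" "j \<in> S" "k \<in> S" "0 < b" "0 < c" "0 < d"
          "b *\<^sub>R \<nu> i + c *\<^sub>R \<nu> j + d *\<^sub>R \<nu> k = 0" and rr: "r i \<le> r j" "r j \<le> r k"
        unfolding R_def by blast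
      \<comment> \<open>A collinear triple would contain an opposite pair, which this branch
        excludes.\<close>
      have nc: "\<not> collinear {0, (\<theta> * b) *\<^sub>R \<nu> i, (\<theta> * b) *\<^sub>R \<nu> i + (\<theta> * c) *\<^sub>R \<nu> j}"
        and z: "(\<theta> * b) *\<^sub>R \<nu> i + (\<theta> * c) *\<^sub>R \<nu> j + (\<theta> * d) *\<^sub>R \<nu> k = 0" if \<theta>: "0 < \<theta>" for \<theta>
      proof -
        show z: "(\<theta> * b) *\<^sub>R \<nu> i + (\<theta> * c) *\<^sub>R \<nu> j + (\<theta> * d) *\<^sub>R \<nu> k = 0"
          using arg_cong[OF t(7), of "\<lambda>x. \<theta> *\<^sub>R x"] by (simp add: scaleR_add_right)
        show "\<not> collinear {0, (\<theta> * b) *\<^sub>R \<nu> i, (\<theta> * b) *\<^sub>R \<nu> i + (\<theta> * c) *\<^sub>R \<nu> j}"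
        proof
          assume "collinear {0, (\<theta> * b) *\<^sub>R \<nu> i, (\<theta> * b) *\<^sub>R \<nu> i + (\<theta> * c) *\<^sub>R \<nu> j}"
          then obtain e where "0 < e"
              "(\<theta> * b) *\<^sub>R \<nu> i + e *\<^sub>R (\<theta> * c) *\<^sub>R \<nu> j = 0 \<or> (\<theta> * b) *\<^sub>R \<nu> i + e *\<^sub>R (\<theta> * d) *\<^sub>R \<nu> k = 0"
            using collinear_dependent_triangle[OF _ z] \<theta> t \<nu> S by fastforce
          then show False
            using nopair t(1-6) \<theta> by (metis mult_pos_pos scaleR_scaleR)
        qed
      qed
      show ?thesis
      proof (rule step[of "circuit3 i j k b c d" i])
        show "(\<Sum>l\<in>J. circuit3 i j k b c d l *\<^sub>R \<nu> l) = 0"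
          using t S by (auto simp: circuit3_def scaleR_add_left sum.distrib if_distrib[of "\<lambda>t. t *\<^sub>R _"] J cong: if_cong)
        fix \<theta> :: real assume \<theta>: "0 < \<theta>"
        have "(\<lambda>l. \<theta> * circuit3 i j k b c d l) = circuit3 i j k (\<theta> * b) (\<theta> * c) (\<theta> * d)"
          by (auto simp: circuit3_def algebra_simps)
        moreover have "G (circuit3 i j k (\<theta> * b) (\<theta> * c) (\<theta> * d))"
          by (rule triple[OF _ _ _ rr _ _ _ z[OF \<theta>] nc[OF \<theta>]]) (use t(1-6) S \<theta> in auto)
        ultimately show "G (\<lambda>l. \<theta> * circuit3 i j k b c d l)" by simp
      qed (use t(1-6) in \<open>auto simp: circuit3_def split: if_splits\<close>)
    qed
  qed
qed

section \<open>Closed curves of length at most one\<close>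

text \<open>Minkowski sums of dilates of a convex set: this lets circuits that fit separately be
  superposed, with their lengths as dilation factors.\<close>

lemma convex_scaleR_add:
  fixes x y :: "'a::real_vector"
  assumes K: "convex K" and "0 \<le> a" "0 \<le> b"
    and "x \<in> (\<lambda>z. a *\<^sub>R z) ` K" "y \<in> (\<lambda>z. b *\<^sub>R z) ` K"
  shows "x + y \<in> (\<lambda>z. (a + b) *\<^sub>R z) ` K"
proof -
  obtain u v where uv: "u \<in> K" "v \<in> K" "x = a *\<^sub>R u" "y = b *\<^sub>R v" using assms by blast
  show ?thesis
  proof (cases "a + b = 0")
    case True
    then have "a = 0" "b = 0" using assms by auto
    then show ?thesis using uv by auto
  next
    case False
    have "(a / (a + b)) *\<^sub>R u + (b / (a + b)) *\<^sub>R v \<in> K"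
      using uv assms False by (intro convexD[OF K]) (auto simp flip: add_divide_distrib)
    moreover have "x + y = (a + b) *\<^sub>R ((a / (a + b)) *\<^sub>R u + (b / (a + b)) *\<^sub>R v)"
      using uv False by (simp add: scaleR_add_right)
    ultimately show ?thesis by blast
  qed
qed

lemma fits_convex_hullD:
  assumes "fits (convex hull S) K"
  shows "\<exists>t. \<forall>x\<in>S. x + t \<in> K"
proof -
  obtain t where "(\<lambda>x. x + t) ` (convex hull S) \<subseteq> K" using assms unfolding fits_def by blast
  then have "\<forall>x\<in>S. x + t \<in> K" using hull_inc[of _ S convex] by blast
  then show ?thesis by blast
qed

text \<open>The order in which edges are traversed is encoded by the rank \<open>r\<close>: the vertices of the
  polygon are the sums over the edges of rank less than \<open>m\<close>.  Vertices and length are additive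
  in \<open>a\<close>, so it suffices to treat circuits.\<close>

lemma closed_chain_fits:
  fixes \<nu> :: "'j \<Rightarrow> R2" and r :: "'j \<Rightarrow> nat"
  assumes Q: "convex_polygon Q" and K: "convex K" "K \<noteq> {}"
    and T: "\<And>T. Q_normal_triangle Q T \<Longrightarrow> fits T K"
    and J: "finite J" and \<nu>: "\<And>j. j \<in> J \<Longrightarrow> outward_normal_dir Q (\<nu> j)"
    and a: "\<And>j. 0 \<le> a j" "\<And>j. j \<notin> J \<Longrightarrow> a j = 0" "(\<Sum>j\<in>J. a j *\<^sub>R \<nu> j) = 0"
  shows "0 \<le> (\<Sum>j\<in>J. a j * qnorm Q (\<nu> j)) \<and>
    (\<exists>t. \<forall>m. (\<Sum>j\<in>{j\<in>J. r j < m}. a j *\<^sub>R \<nu> j) + t \<in>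
       (\<lambda>z. (\<Sum>j\<in>J. a j * qnorm Q (\<nu> j)) *\<^sub>R z) ` K)"
    (is "?G a")
proof -
  note Qp = convex_polygonD[OF Q]
  obtain y0 \<rho> where \<rho>: "0 < \<rho>" "cball y0 \<rho> \<subseteq> Q"
    using interior_cballE Qp(5) by blast
  have hs: "qnorm Q (c *\<^sub>R x) = c * qnorm Q x" if "0 \<le> c" for c x
    using qnorm_scaleR[OF Qp(2,4)] that by blast
  \<comment> \<open>A single \<open>qnorm Q (\<nu> j)\<close> may be negative. What survives is this
    strict bound, whose left sides add up to 0 over a circuit, so that the total length is
    positive.\<close>
  have hpos: "c *\<^sub>R \<nu> j \<bullet> y0 < c * qnorm Q (\<nu> j)" if "0 < c" "j \<in> J" for c j
  proof -
    have "\<nu> j \<bullet> y0 + \<rho> * norm (\<nu> j) \<le> qnorm Q (\<nu> j)"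
      using qnorm_ge_cball[OF Qp(2) \<rho>(2)] \<rho>(1) by simp
    moreover have "0 < \<rho> * norm (\<nu> j)"
      using \<rho> \<nu>[OF that(2)] by (simp add: outward_normal_dir_def)
    ultimately show ?thesis using that by simp
  qed
  have out: "outward_normal_dir Q (c *\<^sub>R \<nu> j)" if "0 < c" "j \<in> J" for c j
    using outward_normal_dir_scaleR[OF Qp(2,4)] \<nu> that by blast
  \<comment> \<open>Passes from a triangle of length 1 to a circuit of length
    \<open>l\<close>.\<close>
  have scale: "\<exists>t. \<forall>m. P m + t \<in> (\<lambda>z. l *\<^sub>R z) ` K"
    if S: "fits (convex hull S) K" "\<And>m. (1 / l) *\<^sub>R P m \<in> S" "0 < l" for S l and P :: "nat \<Rightarrow> R2"
  proof -
    obtain t where t: "\<forall>x\<in>S. x + t \<in> K" using fits_convex_hullD[OF S(1)] by blast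
    show ?thesis
    proof (intro exI[of _ "l *\<^sub>R t"] allI)
      fix m
      have "P m + l *\<^sub>R t = l *\<^sub>R ((1 / l) *\<^sub>R P m + t)"
        using S(3) by (simp add: scaleR_add_right)
      then show "P m + l *\<^sub>R t \<in> (\<lambda>z. l *\<^sub>R z) ` K" using t S(2) by blast
    qed
  qed
  have sel: "(\<Sum>l\<in>{j\<in>J. r j < m}. (if l = i then c else 0) *\<^sub>R \<nu> l) = (if r i < m then c *\<^sub>R \<nu> i else 0)"
    if "i \<in> J" for i m c
    using J that by (simp add: if_distrib[of "\<lambda>t. t *\<^sub>R _"] cong: if_cong)
  have sel': "(\<Sum>l\<in>J. (if l = i then c else 0) * qnorm Q (\<nu> l)) = c * qnorm Q (\<nu> i)"
    if "i \<in> J" for i c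
    using J that by (simp add: if_distrib[of "\<lambda>t. t * _"] cong: if_cong)
  show ?thesis
  proof (rule positive_dependency_induct[where G = ?G and r = r and \<nu> = \<nu>, OF J _ a])
    show "\<nu> j \<noteq> 0" if "j \<in> J" for j using \<nu>[OF that] unfolding outward_normal_dir_def by blast
    show "?G (\<lambda>_. 0)" using K(2) by (auto simp: image_iff)
  next
    fix b c assume b: "?G b" and c: "?G c"
    let ?P = "\<lambda>a m. \<Sum>j\<in>{j\<in>J. r j < m}. a j *\<^sub>R \<nu> j"
    let ?l = "\<lambda>a. \<Sum>j\<in>J. a j * qnorm Q (\<nu> j)"
    obtain s where s: "\<forall>m. ?P b m + s \<in> (\<lambda>z. ?l b *\<^sub>R z) ` K" using conjunct2[OF b] by (elim exE)
    obtain t where t: "\<forall>m. ?P c m + t \<in> (\<lambda>z. ?l c *\<^sub>R z) ` K" using conjunct2[OF c] by (elim exE)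
    have l: "?l (\<lambda>j. b j + c j) = ?l b + ?l c" by (simp add: algebra_simps sum.distrib)
    have "?P (\<lambda>j. b j + c j) m + (s + t) \<in> (\<lambda>z. (?l b + ?l c) *\<^sub>R z) ` K" for m
    proof -
      have eq: "?P (\<lambda>j. b j + c j) m + (s + t) = (?P b m + s) + (?P c m + t)"
        by (simp add: scaleR_add_left sum.distrib)
      show ?thesis
        unfolding eq
        by (rule convex_scaleR_add[OF K(1) conjunct1[OF b] conjunct1[OF c] spec[OF s] spec[OF t]])
    qed
    then show "?G (\<lambda>j. b j + c j)"
      unfolding l using add_nonneg_nonneg[OF conjunct1[OF b] conjunct1[OF c]] by blast
  next
    fix i j b c
    assume ij: "i \<in> J" "j \<in> J" "r i \<le> r j" and bc: "0 < b" "0 < c" "b *\<^sub>R \<nu> i + c *\<^sub>R \<nu> j = 0"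
    define l where "l = b * qnorm Q (\<nu> i) + c * qnorm Q (\<nu> j)"
    have "(b *\<^sub>R \<nu> i + c *\<^sub>R \<nu> j) \<bullet> y0 < l"
      unfolding l_def inner_add_left using hpos ij bc by (intro add_strict_mono) auto
    then have l: "0 < l" using bc by simp
    have le: "(\<Sum>l\<in>J. circuit2 i j b c l * qnorm Q (\<nu> l)) = l"
      unfolding l_def circuit2_def using sel' ij by (simp add: distrib_right sum.distrib)
    let ?v = "(1 / l) *\<^sub>R b *\<^sub>R \<nu> i"
    have d: "0 - ?v = (c / l) *\<^sub>R \<nu> j" "?v - 0 = (b / l) *\<^sub>R \<nu> i"
      using arg_cong[OF bc(3), of "\<lambda>x. (1 / l) *\<^sub>R x"] by (auto simp: scaleR_add_right neg_eq_iff_add_eq_0)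
    have "Q_normal_triangle Q (closed_segment 0 ?v)"
      unfolding Q_normal_triangle_def
    proof (intro disjI2 exI conjI)
      show "0 \<noteq> ?v" using out[OF bc(1) ij(1)] l bc unfolding outward_normal_dir_def by auto
      show "outward_normal_dir Q (?v - 0)" "outward_normal_dir Q (0 - ?v)"
        unfolding d using out ij bc l by auto
      show "qnorm Q (?v - 0) + qnorm Q (0 - ?v) = 1"
        unfolding d using bc l by (simp add: hs l_def flip: add_divide_distrib)
    qed simp
    then have f: "fits (convex hull {0, ?v}) K" using T by (simp add: segment_convex_hull)
    have "\<exists>t. \<forall>m. (\<Sum>l\<in>{j\<in>J. r j < m}. circuit2 i j b c l *\<^sub>R \<nu> l) + t \<in> (\<lambda>z. l *\<^sub>R z) ` K"
    proof (rule scale[OF f _ l])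
      fix m
      \<comment> \<open>Since \<open>r i \<le> r j\<close>, the second edge is never present without
        the first; with both present the sum is back at 0.\<close>
      have "(\<Sum>l\<in>{j\<in>J. r j < m}. circuit2 i j b c l *\<^sub>R \<nu> l) \<in> {0, b *\<^sub>R \<nu> i}"
        unfolding circuit2_def using sel ij bc(3) by (auto simp: scaleR_add_left sum.distrib)
      then show "(1 / l) *\<^sub>R (\<Sum>l\<in>{j\<in>J. r j < m}. circuit2 i j b c l *\<^sub>R \<nu> l) \<in> {0, ?v}" by auto
    qed
    then show "?G (circuit2 i j b c)" unfolding le using l by simp
  next
    fix i j k b c d
    assume ij: "i \<in> J" "j \<in> J" "k \<in> J" "r i \<le> r j" "r j \<le> r k" and bc: "0 < b" "0 < c" "0 < d"
      "b *\<^sub>R \<nu> i + c *\<^sub>R \<nu> j + d *\<^sub>R \<nu> k = 0"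
      and nc: "\<not> collinear {0, b *\<^sub>R \<nu> i, b *\<^sub>R \<nu> i + c *\<^sub>R \<nu> j}"
    define l where "l = b * qnorm Q (\<nu> i) + c * qnorm Q (\<nu> j) + d * qnorm Q (\<nu> k)"
    have "(b *\<^sub>R \<nu> i + c *\<^sub>R \<nu> j + d *\<^sub>R \<nu> k) \<bullet> y0 < l"
      unfolding l_def inner_add_left using hpos ij bc by (intro add_strict_mono) auto
    then have l: "0 < l" using bc by simp
    have le: "(\<Sum>l\<in>J. circuit3 i j k b c d l * qnorm Q (\<nu> l)) = l"
      unfolding l_def circuit3_def using sel' ij by (simp add: distrib_right sum.distrib)
    let ?v = "(1 / l) *\<^sub>R b *\<^sub>R \<nu> i" and ?w = "(1 / l) *\<^sub>R (b *\<^sub>R \<nu> i + c *\<^sub>R \<nu> j)"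
    have d: "?v - 0 = (b / l) *\<^sub>R \<nu> i" "?w - ?v = (c / l) *\<^sub>R \<nu> j" "0 - ?w = (d / l) *\<^sub>R \<nu> k"
      using arg_cong[OF bc(4), of "\<lambda>x. (1 / l) *\<^sub>R x"]
      by (auto simp: scaleR_add_right add_eq_0_iff algebra_simps)
    have "Q_normal_triangle Q (convex hull {0, ?v, ?w})"
      unfolding Q_normal_triangle_def
    proof (intro disjI1 exI conjI)
      show "\<not> collinear {0, ?v, ?w}" using nc l by (simp only: collinear_scaleR_iff) simp
      show "outward_normal_dir Q (?v - 0)" "outward_normal_dir Q (?w - ?v)" "outward_normal_dir Q (0 - ?w)"
        unfolding d using out ij bc l by auto
      show "qnorm Q (?v - 0) + qnorm Q (?w - ?v) + qnorm Q (0 - ?w) = 1"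
        unfolding d using bc l by (simp add: hs l_def flip: add_divide_distrib)
    qed simp
    then have f: "fits (convex hull {0, ?v, ?w}) K" using T by blast
    have "\<exists>t. \<forall>m. (\<Sum>l\<in>{j\<in>J. r j < m}. circuit3 i j k b c d l *\<^sub>R \<nu> l) + t \<in> (\<lambda>z. l *\<^sub>R z) ` K"
    proof (rule scale[OF f _ l])
      fix m
      \<comment> \<open>By the rank order only initial segments of \<open>i\<close>,
        \<open>j\<close>, \<open>k\<close> occur, so the partial sums are vertices of the
        triangle.\<close>
      have "(\<Sum>l\<in>{j\<in>J. r j < m}. circuit3 i j k b c d l *\<^sub>R \<nu> l) \<in> {0, b *\<^sub>R \<nu> i, b *\<^sub>R \<nu> i + c *\<^sub>R \<nu> j}"
        unfolding circuit3_def using sel ij bc(4) by (auto simp: scaleR_add_left sum.distrib)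
      then show "(1 / l) *\<^sub>R (\<Sum>l\<in>{j\<in>J. r j < m}. circuit3 i j k b c d l *\<^sub>R \<nu> l) \<in> {0, ?v, ?w}" by auto
    qed
    then show "?G (circuit3 i j k b c d)" unfolding le using l by simp
  qed
qed

lemma closed_edges_fit:
  fixes e :: "nat \<Rightarrow> R2"
  assumes Q: "convex_polygon Q" and K: "convex K" "K \<noteq> {}"
    and T: "\<And>T. Q_normal_triangle Q T \<Longrightarrow> fits T K"
    and e: "(\<Sum>i<n. e i) = 0" "(\<Sum>i<n. qnorm Q (e i)) \<le> 1"
  obtains t where "\<And>m. m \<le> n \<Longrightarrow> (\<Sum>i<m. e i) + t \<in> K"
proof -
  obtain N where N: "finite N" "\<And>v. v \<in> N \<Longrightarrow> outward_normal_dir Q v"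
    "\<And>x. \<exists>c. (\<forall>v\<in>N. 0 \<le> c v) \<and> x = (\<Sum>v\<in>N. c v *\<^sub>R v) \<and>
        (\<Sum>v\<in>N. c v * qnorm Q v) \<le> qnorm Q x"
    using polygon_normals[OF Q] by blast
  have ex: "\<forall>x. \<exists>c. (\<forall>v\<in>N. 0 \<le> c v) \<and> x = (\<Sum>v\<in>N. c v *\<^sub>R v) \<and>
        (\<Sum>v\<in>N. c v * qnorm Q v) \<le> qnorm Q x"
    using N(3) by (intro allI)
  obtain c where c': "\<forall>x. (\<forall>v\<in>N. 0 \<le> c x v) \<and> x = (\<Sum>v\<in>N. c x v *\<^sub>R v) \<and>
        (\<Sum>v\<in>N. c x v * qnorm Q v) \<le> qnorm Q x"
    using choice[OF ex] by (elim exE)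
  have c: "\<And>x v. v \<in> N \<Longrightarrow> 0 \<le> c x v" "\<And>x. x = (\<Sum>v\<in>N. c x v *\<^sub>R v)"
      "\<And>x. (\<Sum>v\<in>N. c x v * qnorm Q v) \<le> qnorm Q x"
    using c' by blast+
  \<comment> \<open>All pieces of edge \<open>i\<close> share the rank \<open>i\<close>, so the
    partial sums by rank stop exactly at the vertices of the unrefined polygon.\<close>
  define J where "J = {..<n} \<times> N"
  define a where "a p = (if p \<in> J then c (e (fst p)) (snd p) else 0)" for p
  have P: "(\<Sum>p\<in>{p\<in>J. fst p < m}. a p *\<^sub>R snd p) = (\<Sum>i<m. e i)" if "m \<le> n" for m
  proof -
    have "{p\<in>J. fst p < m} = {..<m} \<times> N" using that unfolding J_def by auto
    then have "(\<Sum>p\<in>{p\<in>J. fst p < m}. a p *\<^sub>R snd p) = (\<Sum>i<m. \<Sum>v\<in>N. a (i, v) *\<^sub>R v)"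
      by (simp add: sum.cartesian_product case_prod_unfold)
    also have "\<dots> = (\<Sum>i<m. e i)"
    proof (rule sum.cong[OF refl])
      fix i assume "i \<in> {..<m}"
      then have "(\<Sum>v\<in>N. a (i, v) *\<^sub>R v) = (\<Sum>v\<in>N. c (e i) v *\<^sub>R v)"
        using that by (intro sum.cong) (auto simp: a_def J_def)
      also have "\<dots> = e i" using c(2)[of "e i"] by simp
      finally show "(\<Sum>v\<in>N. a (i, v) *\<^sub>R v) = e i" .
    qed
    finally show ?thesis .
  qed
  define l where "l = (\<Sum>p\<in>J. a p * qnorm Q (snd p))"
  have "l = (\<Sum>i<n. \<Sum>v\<in>N. a (i, v) * qnorm Q v)"
    unfolding l_def J_def by (simp add: sum.cartesian_product case_prod_unfold)
  also have "\<dots> = (\<Sum>i<n. \<Sum>v\<in>N. c (e i) v * qnorm Q v)"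
    by (intro sum.cong) (auto simp: a_def J_def)
  also have "\<dots> \<le> (\<Sum>i<n. qnorm Q (e i))" by (intro sum_mono c)
  finally have l1: "l \<le> 1" using e by simp
  have "{p \<in> J. fst p < n} = J" unfolding J_def by auto
  then have a0: "(\<Sum>p\<in>J. a p *\<^sub>R snd p) = 0" using P[of n] e by simp
  have fin: "finite J" unfolding J_def using N by simp
  have "0 \<le> l \<and> (\<exists>t. \<forall>m. (\<Sum>p\<in>{p\<in>J. fst p < m}. a p *\<^sub>R snd p) + t \<in> (\<lambda>z. l *\<^sub>R z) ` K)"
    unfolding l_def
    by (rule closed_chain_fits[OF Q K T fin _ _ _ a0]) (use N c in \<open>auto simp: a_def J_def\<close>)
  then obtain t where t: "0 \<le> l" "\<And>m. (\<Sum>p\<in>{p\<in>J. fst p < m}. a p *\<^sub>R snd p) + t \<in> (\<lambda>z. l *\<^sub>R z) ` K"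
    by blast
  \<comment> \<open>The chain fills only the dilate of \<open>K\<close> by \<open>l \<le> 1\<close>;
    the weight \<open>1 - l\<close> left over goes to a fixed point of \<open>K\<close>.\<close>
  obtain x0 where x0: "x0 \<in> K" using K by blast
  show thesis
  proof (rule that[of "t + (1 - l) *\<^sub>R x0"])
    fix m assume m: "m \<le> n"
    obtain z where z: "z \<in> K" "(\<Sum>i<m. e i) + t = l *\<^sub>R z" using t(2)[of m] P[OF m] by auto
    have "l *\<^sub>R z + (1 - l) *\<^sub>R x0 \<in> K"
      using z x0 t l1 by (intro convexD[OF K(1)]) auto
    then show "(\<Sum>i<m. e i) + (t + (1 - l) *\<^sub>R x0) \<in> K"
      using z(2) by (simp flip: add.assoc)
  qed
qed

lemma closed_polygon_fits:
  fixes ps :: "R2 list"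
  assumes Q: "convex_polygon Q" and K: "convex K" "K \<noteq> {}"
    and T: "\<And>T. Q_normal_triangle Q T \<Longrightarrow> fits T K"
    and ps: "closed_poly_qlength Q ps \<le> 1"
  obtains t where "\<And>x. x \<in> set ps \<Longrightarrow> x + t \<in> K"
proof (cases "ps = []")
  case True
  then show thesis using that by simp
next
  case False
  define n where "n = length ps"
  have n: "0 < n" using False unfolding n_def by simp
  define p where "p i = ps ! (i mod n)" for i
  define e where "e i = p (Suc i) - p i" for i
  have tel: "(\<Sum>i<m. e i) = p m - p 0" for m
    unfolding e_def by (rule sum_lessThan_telescope)
  have e0: "(\<Sum>i<n. e i) = 0" unfolding tel by (simp add: p_def)
  have "(\<Sum>i<n. qnorm Q (e i)) = closed_poly_qlength Q ps"
    unfolding closed_poly_qlength_def n_def[symmetric] e_def p_def by simp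
  then obtain t where t: "\<And>m. m \<le> n \<Longrightarrow> (\<Sum>i<m. e i) + t \<in> K"
    using closed_edges_fit[OF Q K T e0] ps by auto
  show thesis
  proof (rule that[of "t - p 0"])
    fix x assume "x \<in> set ps"
    then obtain m where m: "m < n" "x = ps ! m" unfolding n_def by (metis in_set_conv_nth)
    then have "x = p m" unfolding p_def by simp
    then show "x + (t - p 0) \<in> K" using t[of m] m tel by (simp add: algebra_simps)
  qed
qed

text \<open>For each \<open>s\<close> the admissible translations form a translate of
  \<open>K\<close>, and the finite intersection property applies to these compact sets.\<close>

lemma translates_fit_compact:
  fixes \<gamma> :: "'i \<Rightarrow> R2"
  assumes K: "compact K"
    and fin: "\<And>F. finite F \<Longrightarrow> F \<subseteq> I \<Longrightarrow> \<exists>t. \<forall>s\<in>F. \<gamma> s + t \<in> K"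
  shows "\<exists>t. \<forall>s\<in>I. \<gamma> s + t \<in> K"
proof (cases "I = {}")
  case False
  then obtain s0 where s0: "s0 \<in> I" by blast
  have im: "t \<in> (\<lambda>x. x - \<gamma> s) ` K \<longleftrightarrow> \<gamma> s + t \<in> K" for s t
    by (force simp: image_iff algebra_simps)
  have c: "compact ((\<lambda>x. x - \<gamma> s) ` K)" for s
    using compact_translation[OF K, of "- \<gamma> s"] by (simp add: algebra_simps)
  have "(\<lambda>x. x - \<gamma> s0) ` K \<inter> (\<Inter>s\<in>I. (\<lambda>x. x - \<gamma> s) ` K) \<noteq> {}"
  proof (rule compact_imp_fip_image[OF c])
    show "closed ((\<lambda>x. x - \<gamma> s) ` K)" for s using c compact_imp_closed by blast
    fix F assume F: "finite F" "F \<subseteq> I"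
    then obtain t where "\<forall>s\<in>insert s0 F. \<gamma> s + t \<in> K" using fin[of "insert s0 F"] s0 by auto
    then have "t \<in> (\<lambda>x. x - \<gamma> s0) ` K \<inter> (\<Inter>s\<in>F. (\<lambda>x. x - \<gamma> s) ` K)"
      using im by auto
    then show "(\<lambda>x. x - \<gamma> s0) ` K \<inter> (\<Inter>s\<in>F. (\<lambda>x. x - \<gamma> s) ` K) \<noteq> {}" by blast
  qed
  then obtain t where "\<forall>s\<in>I. t \<in> (\<lambda>x. x - \<gamma> s) ` K" by blast
  then show ?thesis unfolding im by blast
qed simp

text \<open>Stated through inscribed polygons over an arbitrary parameter set, to serve both curves
  on \<open>{0..1}\<close> and rescaled position components of characteristics.\<close>

lemma short_loop_fits:
  fixes \<gamma> :: "real \<Rightarrow> R2"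
  assumes Q: "convex_polygon Q" and K: "convex_shape K"
    and T: "\<And>T. Q_normal_triangle Q T \<Longrightarrow> fits T K"
    and len: "\<And>ts. ts \<noteq> [] \<Longrightarrow> sorted ts \<Longrightarrow> set ts \<subseteq> I \<Longrightarrow> closed_poly_qlength Q (map \<gamma> ts) \<le> 1"
  shows "\<exists>t. \<forall>s\<in>I. \<gamma> s + t \<in> K"
proof (rule translates_fit_compact)
  have Kp: "compact K" "convex K" "K \<noteq> {}" using K unfolding convex_shape_def by auto
  then show "compact K" by simp
  fix F assume F: "finite F" "F \<subseteq> I"
  show "\<exists>t. \<forall>s\<in>F. \<gamma> s + t \<in> K"
  proof (cases "F = {}")
    case False
    define ts where "ts = sorted_list_of_set F"
    have ts: "set ts = F" "sorted ts" "ts \<noteq> []" unfolding ts_def using F False by auto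
    obtain t where "\<And>x. x \<in> set (map \<gamma> ts) \<Longrightarrow> x + t \<in> K"
      using closed_polygon_fits[OF Q Kp(2,3) T len] ts F by blast
    then show ?thesis using ts by auto
  qed simp
qed

lemma unit_curve_fits:
  assumes Q: "convex_polygon Q" and K: "convex_shape K"
    and T: "\<And>T. Q_normal_triangle Q T \<Longrightarrow> fits T K"
    and \<gamma>: "unit_qlength Q \<gamma>"
  shows "fits (\<gamma> ` {0..1}) K"
proof -
  have "\<exists>t. \<forall>s\<in>{0..1}. \<gamma> s + t \<in> K"
  proof (rule short_loop_fits[OF Q K T])
    fix ts :: "real list" assume "ts \<noteq> []" "sorted ts" "set ts \<subseteq> {0..1}"
    then have "closed_poly_qlength Q (map \<gamma> ts) \<in> inscribed_qlengths Q \<gamma>"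
      unfolding inscribed_qlengths_def by blast
    then show "closed_poly_qlength Q (map \<gamma> ts) \<le> 1"
      using \<gamma> cSup_upper unfolding unit_qlength_def by metis
  qed
  then show ?thesis unfolding fits_def by blast
qed

section \<open>Indefinite integrals\<close>

lemma indefinite_integral_diff:
  fixes f :: "real \<Rightarrow> 'a::banach"
  assumes "f' integrable_on {a..b}" "\<And>t. t \<in> {a..b} \<Longrightarrow> f t = f a + integral {a..t} f'"
    and "a \<le> s" "s \<le> t" "t \<le> b"
  shows "(f' has_integral f t - f s) {s..t}"
proof -
  have "f' integrable_on {a..t}" "f' integrable_on {s..t}"
    using assms by (auto intro: integrable_subinterval_real)
  then have "integral {a..s} f' + integral {s..t} f' = integral {a..t} f'"
    using assms by (intro Henstock_Kurzweil_Integration.integral_combine) auto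
  then have "integral {s..t} f' = f t - f s"
    using assms(2)[of s] assms(2)[of t] assms(3-5) by (simp add: algebra_simps)
  then show ?thesis using \<open>f' integrable_on {s..t}\<close> by (metis integrable_integral)
qed

lemma indefinite_integral_continuous:
  fixes f :: "real \<Rightarrow> 'a::banach"
  assumes "f' integrable_on {a..b}" "\<And>t. t \<in> {a..b} \<Longrightarrow> f t = f a + integral {a..t} f'"
  shows "continuous_on {a..b} f"
proof -
  have "continuous_on {a..b} (\<lambda>t. f a + integral {a..t} f')"
    by (intro continuous_intros indefinite_integral_continuous_1 assms)
  then show ?thesis using assms(2) by (metis (no_types, lifting) continuous_on_cong)
qed

lemma absolutely_integrable_inner_continuous:
  fixes f g :: "real \<Rightarrow> 'a::euclidean_space"
  assumes "continuous_on {a..b} f" "g absolutely_integrable_on {a..b}"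
  shows "(\<lambda>t. f t \<bullet> g t) absolutely_integrable_on {a..b}"
proof (rule absolutely_integrable_bounded_measurable_product[of inner])
  show "bilinear (inner :: 'a \<Rightarrow> 'a \<Rightarrow> real)"
    using bilinear_conv_bounded_bilinear bounded_bilinear_inner by blast
  show "f \<in> borel_measurable (lebesgue_on {a..b})"
    using assms(1) by (intro continuous_imp_measurable_on_sets_lebesgue) auto
  show "bounded (f ` {a..b})"
    using assms(1) compact_continuous_image compact_imp_bounded compact_Icc by blast
qed (use assms in auto)

text \<open>Equal steps shorter than \<open>d\<close> are added up by telescoping.\<close>

lemma locally_dominated_increments:
  fixes \<Phi> I :: "real \<Rightarrow> real"
  assumes "0 \<le> T" "0 < d"
    and inc: "\<And>u v. 0 \<le> u \<Longrightarrow> u \<le> v \<Longrightarrow> v \<le> T \<Longrightarrow> v - u < d \<Longrightarrow> \<bar>\<Phi> v - \<Phi> u\<bar> \<le> I v - I u"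
  shows "\<bar>\<Phi> T - \<Phi> 0\<bar> \<le> I T - I 0"
proof -
  obtain n :: nat where n: "T / d < n" using reals_Archimedean2 by blast
  have n0: "0 < n" using n assms by (metis divide_nonneg_pos gr0I less_le_not_le of_nat_0)
  define x where "x k = real k * T / n" for k
  have st: "x (Suc k) - x k = T / n" for k unfolding x_def by (simp add: algebra_simps add_divide_distrib)
  have "T / n < d" using n n0 assms by (simp add: field_simps)
  have "k \<le> n \<Longrightarrow> \<bar>\<Phi> (x k) - \<Phi> 0\<bar> \<le> I (x k) - I 0" for k
  proof (induction k)
    case 0
    then show ?case by (simp add: x_def)
  next
    case (Suc k)
    have "real (Suc k) * T \<le> real n * T" using Suc.prems assms(1) by (intro mult_right_mono) auto
    then have "x (Suc k) \<le> T" unfolding x_def using n0 by (simp add: field_simps)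
    moreover have "0 \<le> x k" unfolding x_def using assms(1) by simp
    moreover have "x k \<le> x (Suc k)" using st[of k] assms(1) n0 by (smt (verit) divide_nonneg_nonneg of_nat_0_le_iff)
    ultimately have "\<bar>\<Phi> (x (Suc k)) - \<Phi> (x k)\<bar> \<le> I (x (Suc k)) - I (x k)"
      using inc st \<open>T / n < d\<close> by simp
    then show ?case using Suc by simp
  qed
  from this[of n] show ?thesis unfolding x_def using n0 by simp
qed

text \<open>The library's integration by parts needs pointwise derivatives off a countable set, whereas
  here \<open>f\<close> and \<open>g\<close> are merely absolutely continuous.  On a subinterval of small length the
  product rule fails by at most \<open>\<epsilon>\<close> times the integral of \<open>norm f' + norm g'\<close>, and these
  errors add up.\<close>

lemma integration_by_parts_indefinite:
  fixes f g f' g' :: "real \<Rightarrow> 'a::euclidean_space"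
  assumes T: "0 \<le> T" and f': "f' absolutely_integrable_on {0..T}" and g': "g' absolutely_integrable_on {0..T}"
    and f: "\<And>t. t \<in> {0..T} \<Longrightarrow> f t = f 0 + integral {0..t} f'"
    and g: "\<And>t. t \<in> {0..T} \<Longrightarrow> g t = g 0 + integral {0..t} g'"
  shows "integral {0..T} (\<lambda>t. f' t \<bullet> g t) + integral {0..T} (\<lambda>t. g' t \<bullet> f t) = f T \<bullet> g T - f 0 \<bullet> g 0"
proof -
  have fi: "f' integrable_on {0..T}" and gi: "g' integrable_on {0..T}"
    using f' g' set_lebesgue_integral_eq_integral(1) by blast+
  have fc: "continuous_on {0..T} f" and gc: "continuous_on {0..T} g"
    using indefinite_integral_continuous[of _ 0 T] fi gi f g by blast+
  have i1: "(\<lambda>t. f' t \<bullet> g t) integrable_on {0..T}" and i2: "(\<lambda>t. g' t \<bullet> f t) integrable_on {0..T}"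
    using absolutely_integrable_inner_continuous[OF gc f'] absolutely_integrable_inner_continuous[OF fc g']
      set_lebesgue_integral_eq_integral(1) by (simp_all add: inner_commute)
  define h where "h t = f' t \<bullet> g t + g' t \<bullet> f t" for t
  have hi: "h integrable_on {0..T}" unfolding h_def using i1 i2 by (rule integrable_add)
  define H where "H t = norm (f' t) + norm (g' t)" for t
  have Hi: "H integrable_on {0..T}" unfolding H_def
    using f' g' absolutely_integrable_on_def by (intro integrable_add) blast+
  \<comment> \<open>The defect of the product rule, to be shown constant between the two
    ends.\<close>
  define \<Phi> where "\<Phi> t = f t \<bullet> g t - integral {0..t} h" for t
  define I where "I t = integral {0..t} H" for t
  have hd: "(h has_integral integral {0..v} h - integral {0..u} h) {u..v}"
    and Hd: "(H has_integral I v - I u) {u..v}" if "0 \<le> u" "u \<le> v" "v \<le> T" for u v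
    using indefinite_integral_diff[OF hi _ that, of "\<lambda>t. integral {0..t} h"]
      indefinite_integral_diff[OF Hi _ that, of I] unfolding I_def by auto
  have main: "\<bar>\<Phi> T - \<Phi> 0\<bar> \<le> e * I T" if e: "0 < e" for e
  proof -
    have "uniformly_continuous_on {0..T} f" "uniformly_continuous_on {0..T} g"
      using fc gc compact_uniformly_continuous compact_Icc by blast+
    then obtain d1 d2 where d: "0 < d1" "0 < d2"
        "\<And>x y. x \<in> {0..T} \<Longrightarrow> y \<in> {0..T} \<Longrightarrow> dist x y < d1 \<Longrightarrow> dist (f x) (f y) < e"
        "\<And>x y. x \<in> {0..T} \<Longrightarrow> y \<in> {0..T} \<Longrightarrow> dist x y < d2 \<Longrightarrow> dist (g x) (g y) < e"
      unfolding uniformly_continuous_on_def using e by metis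
    have "\<bar>\<Phi> T - \<Phi> 0\<bar> \<le> e * I T - e * I 0"
    proof (rule locally_dominated_increments[OF T, of "min d1 d2" _ "\<lambda>t. e * I t"])
      fix u v assume uv: "0 \<le> u" "u \<le> v" "v \<le> T" "v - u < min d1 d2"
      \<comment> \<open>Freezing \<open>g\<close> at the right end and \<open>f\<close> at the left
        end makes the integral exactly \<open>f v \<bullet> g v - f u \<bullet> g u\<close>; the
        freezing error is what uniform continuity controls.\<close>
      have a: "((\<lambda>s. f' s \<bullet> g v) has_integral (f v - f u) \<bullet> g v) {u..v}"
        using has_integral_linear[OF indefinite_integral_diff[OF fi f uv(1-3)] bounded_linear_inner_left]
        by (simp add: o_def)
      have b: "((\<lambda>s. g' s \<bullet> f u) has_integral (g v - g u) \<bullet> f u) {u..v}"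
        using has_integral_linear[OF indefinite_integral_diff[OF gi g uv(1-3)] bounded_linear_inner_left]
        by (simp add: o_def)
      have "((\<lambda>s. f' s \<bullet> g v + g' s \<bullet> f u - h s) has_integral
          (f v - f u) \<bullet> g v + (g v - g u) \<bullet> f u - (integral {0..v} h - integral {0..u} h)) {u..v}"
        by (intro has_integral_diff has_integral_add a b hd uv)
      moreover have "(f v - f u) \<bullet> g v + (g v - g u) \<bullet> f u - (integral {0..v} h - integral {0..u} h) = \<Phi> v - \<Phi> u"
        unfolding \<Phi>_def by (simp add: inner_diff_left inner_diff_right inner_commute)
      ultimately have D: "((\<lambda>s. f' s \<bullet> g v + g' s \<bullet> f u - h s) has_integral \<Phi> v - \<Phi> u) {u..v}" by simp
      have E: "((\<lambda>s. e * H s) has_integral e * (I v - I u)) {u..v}"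
        using Hd[OF uv(1-3)] by (rule has_integral_mult_right)
      have "norm (\<Phi> v - \<Phi> u) \<le> e * (I v - I u)"
      proof (rule integral_norm_bound_integral[of "\<lambda>s. f' s \<bullet> g v + g' s \<bullet> f u - h s" "{u..v}" "\<lambda>s. e * H s", unfolded integral_unique[OF D] integral_unique[OF E]])
        show "(\<lambda>s. f' s \<bullet> g v + g' s \<bullet> f u - h s) integrable_on {u..v}" using D by blast
        show "(\<lambda>s. e * H s) integrable_on {u..v}" using E by blast
        fix s assume s: "s \<in> {u..v}"
        have "norm (g v - g s) \<le> e" "norm (f u - f s) \<le> e"
          using d(3)[of u s] d(4)[of v s] s uv by (auto simp: dist_norm)
        have "f' s \<bullet> g v + g' s \<bullet> f u - h s = f' s \<bullet> (g v - g s) + g' s \<bullet> (f u - f s)"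
          unfolding h_def by (simp add: inner_diff_right)
        also have "norm \<dots> \<le> norm (f' s) * norm (g v - g s) + norm (g' s) * norm (f u - f s)"
          by (intro norm_triangle_le add_mono) (auto simp: Cauchy_Schwarz_ineq2)
        also have "\<dots> \<le> norm (f' s) * e + norm (g' s) * e"
          using \<open>norm (g v - g s) \<le> e\<close> \<open>norm (f u - f s) \<le> e\<close> by (intro add_mono mult_left_mono) auto
        finally show "norm (f' s \<bullet> g v + g' s \<bullet> f u - h s) \<le> e * H s"
          unfolding H_def by (simp add: algebra_simps)
      qed
      then show "\<bar>\<Phi> v - \<Phi> u\<bar> \<le> e * I v - e * I u" by (simp add: algebra_simps)
    qed (use d in auto)
    then show ?thesis unfolding I_def by simp
  qed
  have "\<bar>\<Phi> T - \<Phi> 0\<bar> \<le> 0"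
  proof (rule field_le_epsilon)
    fix e :: real assume e: "0 < e"
    have I0: "0 \<le> I T" unfolding I_def H_def by (intro integral_nonneg Hi[unfolded H_def]) auto
    have "\<bar>\<Phi> T - \<Phi> 0\<bar> \<le> e / (I T + 1) * I T" using I0 e by (intro main) simp
    also have "\<dots> \<le> e" using I0 e by (simp add: field_simps)
    finally show "\<bar>\<Phi> T - \<Phi> 0\<bar> \<le> 0 + e" by simp
  qed
  then have "f T \<bullet> g T - f 0 \<bullet> g 0 = integral {0..T} h" unfolding \<Phi>_def by simp
  also have "\<dots> = integral {0..T} (\<lambda>t. f' t \<bullet> g t) + integral {0..T} (\<lambda>t. g' t \<bullet> f t)"
    unfolding h_def using i1 i2 by (rule integral_add)
  finally show ?thesis by simp
qed

section \<open>The action of closed characteristics\<close>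

text \<open>Because \<open>Jsymp\<close> swaps the components with a sign, \<open>q'\<close> is
  normal to \<open>Q\<close> at \<open>p\<close> and \<open>- p'\<close> is normal to
  \<open>K\<close> at \<open>q\<close>.\<close>

lemma closed_gen_char_components:
  assumes ch: "closed_gen_char (K \<times> Q) T z z'" and K: "compact K" and Q: "compact Q"
  obtains q' p' q p where "0 < T" "q' absolutely_integrable_on {0..T}" "p' absolutely_integrable_on {0..T}"
    "\<And>t. t \<in> {0..T} \<Longrightarrow> q t = q 0 + integral {0..t} q'"
    "\<And>t. t \<in> {0..T} \<Longrightarrow> p t = p 0 + integral {0..t} p'"
    "q T = q 0" "p T = p 0" "\<And>t. t \<in> {0..T} \<Longrightarrow> q t \<in> K" "\<And>t. t \<in> {0..T} \<Longrightarrow> p t \<in> Q"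
    "\<And>t x. t \<in> {0..T} \<Longrightarrow> x \<in> K \<Longrightarrow> p' t \<bullet> q t \<le> p' t \<bullet> x"
    "\<And>t y. t \<in> {0..T} \<Longrightarrow> y \<in> Q \<Longrightarrow> q' t \<bullet> y \<le> q' t \<bullet> p t"
    "\<exists>t\<in>{0..T}. q t \<noteq> q 0 \<or> p t \<noteq> p 0"
    "action T z z' = integral {0..T} (\<lambda>t. q' t \<bullet> p t)"
proof -
  obtain N where N: "negligible N" "\<forall>t\<in>{0..T} - N. z' t \<in> Jsymp ` normal_cone (K \<times> Q) (z t)"
    using ch unfolding closed_gen_char_def by blast
  have T: "0 < T" and zi: "z' absolutely_integrable_on {0..T}"
    and z: "\<And>t. t \<in> {0..T} \<Longrightarrow> z t = z 0 + integral {0..t} z'"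
    and fr: "\<And>t. t \<in> {0..T} \<Longrightarrow> z t \<in> frontier (K \<times> Q)" and zT: "z T = z 0"
    and nc: "\<exists>t\<in>{0..T}. z t \<noteq> z 0"
    using ch unfolding closed_gen_char_def by blast+
  \<comment> \<open>On the exceptional null set the derivative is replaced by 0, which belongs to
    every normal cone; the cone conditions then hold at every time.\<close>
  define w where "w t = (if t \<in> N then 0 else z' t)" for t
  have wi: "w absolutely_integrable_on {0..T}"
    by (rule absolutely_integrable_spike[OF zi N(1)]) (simp add: w_def)
  have wint: "integral {0..t} w = integral {0..t} z'" for t
    by (rule integral_spike[OF N(1)]) (simp add: w_def)
  have zK: "z t \<in> K \<times> Q" if "t \<in> {0..T}" for t
  proof -
    have "closed (K \<times> Q)" using K Q by (simp add: closed_Times compact_imp_closed)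
    then show ?thesis using fr[OF that] by (metis frontier_subset_eq subsetD)
  qed
  have wn: "\<exists>n. w t = Jsymp n \<and> (\<forall>y\<in>K \<times> Q. n \<bullet> (y - z t) \<le> 0)" if "t \<in> {0..T}" for t
  proof (cases "t \<in> N")
    case True
    have "Jsymp 0 = 0" by (simp add: Jsymp_def zero_prod_def)
    with True show ?thesis by (intro exI[of _ 0]) (simp add: w_def)
  next
    case False
    then have "t \<in> {0..T} - N" using that by blast
    then obtain n where "z' t = Jsymp n" "n \<in> normal_cone (K \<times> Q) (z t)"
      using imageE[OF bspec[OF N(2)]] by metis
    then show ?thesis using False unfolding normal_cone_def by (intro exI[of _ n]) (simp add: w_def)
  qed
  define q p q' p' where "q = fst \<circ> z" and "p = snd \<circ> z" and "q' = fst \<circ> w" and "p' = snd \<circ> w"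
  have wi': "w integrable_on {0..t}" if "t \<in> {0..T}" for t
    using set_lebesgue_integral_eq_integral(1)[OF wi] that by (auto intro: integrable_subinterval_real)
  have qi: "q' absolutely_integrable_on {0..T}" and pi: "p' absolutely_integrable_on {0..T}"
    unfolding q'_def p'_def
    by (intro absolutely_integrable_linear wi bounded_linear_fst bounded_linear_snd)+
  have q: "q t = q 0 + integral {0..t} q'" and p: "p t = p 0 + integral {0..t} p'" if "t \<in> {0..T}" for t
    using z[OF that] wint[of t] integral_linear[OF wi'[OF that] bounded_linear_fst]
      integral_linear[OF wi'[OF that] bounded_linear_snd]
    unfolding q_def p_def q'_def p'_def by simp_all
  have qT: "q T = q 0" "p T = p 0" unfolding q_def p_def using zT by auto
  have qK: "q t \<in> K" and pQ: "p t \<in> Q" if "t \<in> {0..T}" for t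
    using zK[OF that] unfolding q_def p_def by (auto simp: mem_Times_iff)
  have pn: "p' t \<bullet> q t \<le> p' t \<bullet> x" if t: "t \<in> {0..T}" and "x \<in> K" for t x
  proof -
    obtain n where n: "w t = Jsymp n" "\<forall>y\<in>K \<times> Q. n \<bullet> (y - z t) \<le> 0" using wn[OF t] by blast
    have "n \<bullet> ((x, p t) - z t) \<le> 0" using n(2) \<open>x \<in> K\<close> pQ[OF t] by blast
    then have "fst n \<bullet> (x - q t) \<le> 0" unfolding p_def q_def by (simp add: inner_prod_def)
    then show ?thesis unfolding p'_def using n(1) by (simp add: Jsymp_def inner_diff_right)
  qed
  have qn: "q' t \<bullet> y \<le> q' t \<bullet> p t" if t: "t \<in> {0..T}" and "y \<in> Q" for t y
  proof -
    obtain n where n: "w t = Jsymp n" "\<forall>y\<in>K \<times> Q. n \<bullet> (y - z t) \<le> 0" using wn[OF t] by blast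
    have "n \<bullet> ((q t, y) - z t) \<le> 0" using n(2) \<open>y \<in> Q\<close> qK[OF t] by blast
    then have "snd n \<bullet> (y - p t) \<le> 0" unfolding p_def q_def by (simp add: inner_prod_def)
    then show ?thesis unfolding q'_def using n(1) by (simp add: Jsymp_def inner_diff_right)
  qed
  have nc': "\<exists>t\<in>{0..T}. q t \<noteq> q 0 \<or> p t \<noteq> p 0"
    using nc unfolding q_def p_def by (simp add: prod_eq_iff)
  have qc: "continuous_on {0..T} q" and pc: "continuous_on {0..T} p"
    using indefinite_integral_continuous set_lebesgue_integral_eq_integral(1) qi pi q p by blast+
  have i1: "(\<lambda>t. q' t \<bullet> p t) integrable_on {0..T}" and i2: "(\<lambda>t. p' t \<bullet> q t) integrable_on {0..T}"
    using absolutely_integrable_inner_continuous[OF pc qi] absolutely_integrable_inner_continuous[OF qc pi]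
      set_lebesgue_integral_eq_integral(1) by (simp_all add: inner_commute)
  have "integral {0..T} (\<lambda>t. (- Jsymp (z' t)) \<bullet> z t) = integral {0..T} (\<lambda>t. q' t \<bullet> p t - p' t \<bullet> q t)"
    by (rule integral_spike[OF N(1)])
      (simp add: w_def Jsymp_def q_def p_def q'_def p'_def inner_prod_def)
  also have "\<dots> = integral {0..T} (\<lambda>t. q' t \<bullet> p t) - integral {0..T} (\<lambda>t. p' t \<bullet> q t)"
    using i1 i2 by (rule integral_diff)
  \<comment> \<open>Integration by parts without boundary term, as both components are
    closed.\<close>
  also have "\<dots> = 2 * integral {0..T} (\<lambda>t. q' t \<bullet> p t)"
    using integration_by_parts_indefinite[OF _ qi pi q p] T qT by simp
  finally have "action T z z' = integral {0..T} (\<lambda>t. q' t \<bullet> p t)" unfolding action_def by simp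
  then show thesis using that[OF T qi pi q p qT qK pQ pn qn nc'] by blast
qed

lemma closed_poly_qlength_le:
  fixes \<gamma> :: "real \<Rightarrow> R2"
  assumes Q: "compact Q" "Q \<noteq> {}" and T: "0 \<le> T"
    and inc: "\<And>s t. 0 \<le> s \<Longrightarrow> s \<le> t \<Longrightarrow> t \<le> T \<Longrightarrow> qnorm Q (\<gamma> t - \<gamma> s) \<le> G t - G s"
    and cl: "\<gamma> T = \<gamma> 0" and ts: "ts \<noteq> []" "sorted ts" "set ts \<subseteq> {0..T}"
  shows "closed_poly_qlength Q (map \<gamma> ts) \<le> G T - G 0"
proof -
  obtain n where n: "length ts = Suc n" using ts(1) by (cases ts) auto
  have "closed_poly_qlength Q (map \<gamma> ts) =
      (\<Sum>i<n. qnorm Q (\<gamma> (ts ! Suc i) - \<gamma> (ts ! i))) + qnorm Q (\<gamma> (ts ! 0) - \<gamma> (ts ! n))"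
    unfolding closed_poly_qlength_def by (simp add: n)
  also have "(\<Sum>i<n. qnorm Q (\<gamma> (ts ! Suc i) - \<gamma> (ts ! i))) \<le> (\<Sum>i<n. G (ts ! Suc i) - G (ts ! i))"
  proof (intro sum_mono inc)
    fix i assume i: "i \<in> {..<n}"
    show "ts ! i \<le> ts ! Suc i" using ts(2) i n by (intro sorted_nth_mono) auto
    have "ts ! i \<in> set ts" "ts ! Suc i \<in> set ts" using i n by auto
    then show "0 \<le> ts ! i" "ts ! Suc i \<le> T" using ts(3) by auto
  qed
  also have "\<dots> = G (ts ! n) - G (ts ! 0)" by (rule sum_lessThan_telescope)
  \<comment> \<open>The closing edge is compared with the path that runs on to \<open>T\<close> and,
    through \<open>\<gamma> T = \<gamma> 0\<close>, from 0 to the first parameter.\<close>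
  also have "qnorm Q (\<gamma> (ts ! 0) - \<gamma> (ts ! n)) \<le> (G (ts ! 0) - G 0) + (G T - G (ts ! n))"
  proof -
    have "ts ! 0 \<in> set ts" "ts ! n \<in> set ts" using n by auto
    then have b: "ts ! 0 \<in> {0..T}" "ts ! n \<in> {0..T}" using ts(3) by auto
    have "qnorm Q (\<gamma> (ts ! 0) - \<gamma> (ts ! n)) = qnorm Q ((\<gamma> (ts ! 0) - \<gamma> 0) + (\<gamma> T - \<gamma> (ts ! n)))"
      using cl by simp
    also have "\<dots> \<le> qnorm Q (\<gamma> (ts ! 0) - \<gamma> 0) + qnorm Q (\<gamma> T - \<gamma> (ts ! n))"
      by (rule qnorm_add[OF Q])
    also have "\<dots> \<le> (G (ts ! 0) - G 0) + (G T - G (ts ! n))"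
      using b by (intro add_mono inc) auto
    finally show ?thesis .
  qed
  finally show ?thesis by simp
qed

lemma integral_norm_zero_imp_constant:
  fixes f :: "real \<Rightarrow> 'a::euclidean_space"
  assumes "f' absolutely_integrable_on {0..T}" "integral {0..T} (\<lambda>t. norm (f' t)) \<le> 0"
    and f: "\<And>t. t \<in> {0..T} \<Longrightarrow> f t = f 0 + integral {0..t} f'" and t: "t \<in> {0..T}"
  shows "f t = f 0"
proof -
  have i: "f' integrable_on {0..T}" "(\<lambda>t. norm (f' t)) integrable_on {0..T}"
    using assms(1) absolutely_integrable_on_def by blast+
  have it: "f' integrable_on {0..t}" "(\<lambda>t. norm (f' t)) integrable_on {0..t}"
    using i t by (auto intro: integrable_subinterval_real)
  have "norm (integral {0..t} f') \<le> integral {0..t} (\<lambda>t. norm (f' t))"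
    using it by (intro integral_norm_bound_integral) auto
  also have "\<dots> \<le> integral {0..T} (\<lambda>t. norm (f' t))"
    using it i t by (intro integral_subset_le) auto
  finally have "integral {0..t} f' = 0" using assms(2) norm_le_zero_iff order_trans by blast
  then show ?thesis using f[OF t] by simp
qed

lemma integral_inner_const:
  fixes f :: "'a::euclidean_space \<Rightarrow> 'b::euclidean_space"
  assumes "f integrable_on S"
  shows "(\<lambda>s. f s \<bullet> x) integrable_on S" "integral S (\<lambda>s. f s \<bullet> x) = integral S f \<bullet> x"
  using integrable_linear[OF assms bounded_linear_inner_left[of x]]
    integral_linear[OF assms bounded_linear_inner_left[of x]] by (simp_all add: o_def)

text \<open>The first bound makes the set of actions bounded below, so that its infimum is at most
  each of its members; the second is the estimate behind
  \<open>EHZ_capacity (K \<times> Q) \<ge> 1\<close>.\<close>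

lemma action_lower_bound:
  assumes Q: "convex_polygon Q" and K: "convex_shape K"
    and ch: "closed_gen_char (K \<times> Q) T z z'"
  shows "0 \<le> action T z z'"
    and "(\<And>T. Q_normal_triangle Q T \<Longrightarrow> fits T K) \<Longrightarrow> 1 \<le> action T z z'"
proof -
  note Qp = convex_polygonD[OF Q]
  have Kp: "compact K" "convex K" "interior K \<noteq> {}" using K unfolding convex_shape_def by auto
  obtain q' p' q p where T: "0 < T" and qi: "q' absolutely_integrable_on {0..T}"
    and pi: "p' absolutely_integrable_on {0..T}"
    and q: "\<And>t. t \<in> {0..T} \<Longrightarrow> q t = q 0 + integral {0..t} q'"
    and p: "\<And>t. t \<in> {0..T} \<Longrightarrow> p t = p 0 + integral {0..t} p'"
    and qT: "q T = q 0" and pT: "p T = p 0"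
    and qK: "\<And>t. t \<in> {0..T} \<Longrightarrow> q t \<in> K" and pQ: "\<And>t. t \<in> {0..T} \<Longrightarrow> p t \<in> Q"
    and pn: "\<And>t x. t \<in> {0..T} \<Longrightarrow> x \<in> K \<Longrightarrow> p' t \<bullet> q t \<le> p' t \<bullet> x"
    and qn: "\<And>t y. t \<in> {0..T} \<Longrightarrow> y \<in> Q \<Longrightarrow> q' t \<bullet> y \<le> q' t \<bullet> p t"
    and nc: "\<exists>t\<in>{0..T}. q t \<noteq> q 0 \<or> p t \<noteq> p 0"
    and act: "action T z z' = integral {0..T} (\<lambda>t. q' t \<bullet> p t)"
    by (rule closed_gen_char_components[OF ch Kp(1) Qp(2)]) (rule that)
  have q'i: "q' integrable_on {0..T}" and p'i: "p' integrable_on {0..T}"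
    using set_lebesgue_integral_eq_integral(1) qi pi by blast+
  have pc: "continuous_on {0..T} p"
    by (rule indefinite_integral_continuous[OF p'i p])
  define g where "g t = q' t \<bullet> p t" for t
  have gi: "g integrable_on {0..T}"
    using absolutely_integrable_inner_continuous[OF pc qi] set_lebesgue_integral_eq_integral(1)
    unfolding g_def by (simp add: inner_commute)
  define G where "G t = integral {0..t} g" for t
  have Gd: "(g has_integral G t - G s) {s..t}" if "0 \<le> s" "s \<le> t" "t \<le> T" for s t
    using indefinite_integral_diff[OF gi _ that, of G] unfolding G_def by auto
  \<comment> \<open>\<open>g\<close> is the rate of action, and by the normality of
    \<open>q'\<close> it dominates \<open>q' \<bullet> y\<close> for every \<open>y\<close> in
    \<open>Q\<close>; integrate and take the maximum over \<open>y\<close>.\<close>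
  have inc: "qnorm Q (q t - q s) \<le> G t - G s" if st: "0 \<le> s" "s \<le> t" "t \<le> T" for s t
  proof (rule qnorm_le[OF Qp(4)])
    fix y assume y: "y \<in> Q"
    have "((\<lambda>u. q' u \<bullet> y) has_integral (q t - q s) \<bullet> y) {s..t}"
      using has_integral_linear[OF indefinite_integral_diff[OF q'i q st] bounded_linear_inner_left]
      by (simp add: o_def)
    then show "(q t - q s) \<bullet> y \<le> G t - G s"
      by (rule has_integral_le[OF _ Gd[OF st]]) (use qn y st in \<open>auto simp: g_def\<close>)
  qed
  have A: "action T z z' = G T" and G0: "G 0 = 0" unfolding act G_def g_def by auto
  show pos: "0 \<le> action T z z'"
    using inc[of 0 T] T qT G0 A by (simp add: qnorm_0 Qp)
  assume fit: "\<And>T. Q_normal_triangle Q T \<Longrightarrow> fits T K"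
  show "1 \<le> action T z z'"
  proof (rule ccontr)
    assume "\<not> 1 \<le> action T z z'"
    \<comment> \<open>Enlarged by \<open>1 / l\<close>, the loop \<open>q\<close> still has length
      at most 1 and fits. Shrinking back frees the share \<open>1 - l\<close> for a ball inside
      \<open>K\<close>.\<close>
    then obtain l where l: "G T < l" "l < 1" using dense[of "G T" 1] unfolding A by auto
    have l0: "0 < l" using l pos A by simp
    have "\<exists>t. \<forall>s\<in>{0..T}. (1 / l) *\<^sub>R q s + t \<in> K"
    proof (rule short_loop_fits[OF Q K fit])
      fix ts :: "real list" assume ts: "ts \<noteq> []" "sorted ts" "set ts \<subseteq> {0..T}"
      have "closed_poly_qlength Q (map (\<lambda>s. (1 / l) *\<^sub>R q s) ts) \<le> G T / l - G 0 / l"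
      proof (rule closed_poly_qlength_le[OF Qp(2,4) _ _ _ ts])
        fix s t assume st: "0 \<le> s" "s \<le> t" "t \<le> T"
        have "qnorm Q ((1 / l) *\<^sub>R q t - (1 / l) *\<^sub>R q s) = (1 / l) * qnorm Q (q t - q s)"
          using qnorm_scaleR[OF Qp(2,4), of "1 / l" "q t - q s"] l0 by (simp add: scaleR_diff_right)
        also have "\<dots> \<le> (1 / l) * (G t - G s)" using inc[OF st] l0 by (intro mult_left_mono) auto
        finally show "qnorm Q ((1 / l) *\<^sub>R q t - (1 / l) *\<^sub>R q s) \<le> G t / l - G s / l"
          by (simp add: diff_divide_distrib)
      qed (use T qT in auto)
      also have "\<dots> \<le> 1" using l l0 G0 by simp
      finally show "closed_poly_qlength Q (map (\<lambda>s. (1 / l) *\<^sub>R q s) ts) \<le> 1" .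
    qed
    then obtain t where t: "\<And>s. s \<in> {0..T} \<Longrightarrow> (1 / l) *\<^sub>R q s + t \<in> K" by blast
    obtain x0 r where r: "0 < r" "cball x0 r \<subseteq> K" using interior_cballE Kp(3) by blast
    \<comment> \<open>The mixture, with weights \<open>l\<close> and \<open>1 - l\<close>, of the
      translation fitting the enlarged loop and the centre of a ball in \<open>K\<close>;
      \<open>\<delta>\<close> is the radius inherited from that ball.\<close>
    define \<tau> where "\<tau> = l *\<^sub>R t + (1 - l) *\<^sub>R x0"
    define \<delta> where "\<delta> = (1 - l) * r"
    have \<delta>: "0 < \<delta>" unfolding \<delta>_def using l r by simp
    have room: "q s + \<tau> + \<delta> *\<^sub>R u \<in> K" if "s \<in> {0..T}" "norm u \<le> 1" for s u
    proof -
      have "x0 + r *\<^sub>R u \<in> K" using r that by (intro subsetD[OF r(2)]) (simp add: dist_norm)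
      then have "l *\<^sub>R ((1 / l) *\<^sub>R q s + t) + (1 - l) *\<^sub>R (x0 + r *\<^sub>R u) \<in> K"
        using t[OF that(1)] l l0 by (intro convexD[OF Kp(2)]) auto
      moreover have "l *\<^sub>R ((1 / l) *\<^sub>R q s + t) + (1 - l) *\<^sub>R (x0 + r *\<^sub>R u) = q s + \<tau> + \<delta> *\<^sub>R u"
        unfolding \<tau>_def \<delta>_def using l0 by (simp add: scaleR_add_right)
      ultimately show ?thesis by simp
    qed
    \<comment> \<open>The normal condition is tested at the translated point pushed by
      \<open>\<delta>\<close> against \<open>p'\<close>. The right side integrates to 0 because
      \<open>p\<close> is closed.\<close>
    have p'pos: "\<delta> * norm (p' s) \<le> p' s \<bullet> \<tau>" if s: "s \<in> {0..T}" for s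
    proof -
      define u where "u = - (1 / norm (p' s)) *\<^sub>R p' s"
      have "p' s \<bullet> q s \<le> p' s \<bullet> (q s + \<tau> + \<delta> *\<^sub>R u)"
        by (intro pn room s) (simp add: u_def)
      moreover have "p' s \<bullet> u = - norm (p' s)"
        unfolding u_def by (cases "p' s = 0") (auto simp: dot_square_norm power2_eq_square)
      ultimately show ?thesis by (simp add: inner_add_right)
    qed
    have "integral {0..T} (\<lambda>s. \<delta> * norm (p' s)) \<le> integral {0..T} (\<lambda>s. p' s \<bullet> \<tau>)"
      using p'pos pi by (intro integral_le integrable_on_mult_right integral_inner_const p'i)
        (auto simp: absolutely_integrable_on_def)
    also have "integral {0..T} (\<lambda>s. p' s \<bullet> \<tau>) = integral {0..T} p' \<bullet> \<tau>"
      by (rule integral_inner_const[OF p'i])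
    also have "\<dots> = 0" using p[of T] pT T by simp
    finally have "integral {0..T} (\<lambda>s. norm (p' s)) \<le> 0"
      using \<delta> by (simp add: mult_le_0_iff)
    then have pconst: "p t = p 0" if "t \<in> {0..T}" for t
      using integral_norm_zero_imp_constant[OF pi _ p that] by blast
    obtain y0 \<rho> where \<rho>: "0 < \<rho>" "cball y0 \<rho> \<subseteq> Q" using interior_cballE Qp(5) by blast
    \<comment> \<open>The same device for \<open>q'\<close>: with \<open>p\<close> constant the
      vector \<open>p 0 - y0\<close> is fixed, and the right side integrates to 0 because
      \<open>q\<close> is closed.\<close>
    have q'pos: "\<rho> * norm (q' s) \<le> q' s \<bullet> (p 0 - y0)" if s: "s \<in> {0..T}" for s
    proof -
      have "q' s \<bullet> y0 + \<rho> * norm (q' s) \<le> qnorm Q (q' s)"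
        using qnorm_ge_cball[OF Qp(2) \<rho>(2)] \<rho>(1) by simp
      also have "\<dots> \<le> q' s \<bullet> p s" using qn[OF s] by (intro qnorm_le[OF Qp(4)])
      finally show ?thesis using pconst[OF s] by (simp add: inner_diff_right)
    qed
    have "integral {0..T} (\<lambda>s. \<rho> * norm (q' s)) \<le> integral {0..T} (\<lambda>s. q' s \<bullet> (p 0 - y0))"
      using q'pos qi by (intro integral_le integrable_on_mult_right integral_inner_const q'i)
        (auto simp: absolutely_integrable_on_def)
    also have "integral {0..T} (\<lambda>s. q' s \<bullet> (p 0 - y0)) = integral {0..T} q' \<bullet> (p 0 - y0)"
      by (rule integral_inner_const[OF q'i])
    also have "\<dots> = 0" using q[of T] qT T by simp
    finally have "integral {0..T} (\<lambda>s. norm (q' s)) \<le> 0"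
      using \<rho> by (simp add: mult_le_0_iff)
    then have "q t = q 0" if "t \<in> {0..T}" for t
      using integral_norm_zero_imp_constant[OF qi _ q that] by blast
    then show False using nc pconst by blast
  qed
qed

section \<open>Polygonal characteristics\<close>

lemma has_integral_interval_const:
  fixes d :: "'a::euclidean_space"
  assumes "0 \<le> a"
  shows "((\<lambda>s. if s \<in> {a..a + 1} then d else 0) has_integral max 0 (min 1 (t - a)) *\<^sub>R d) {0..t}"
proof -
  have "{a..a + 1} \<inter> {0..t} = {a..min t (a + 1)}" using assms by auto
  moreover have "((\<lambda>s. d) has_integral measure lborel {a..min t (a + 1)} *\<^sub>R d) {a..min t (a + 1)}"
    by (rule has_integral_const_real)
  moreover have "measure lborel {a..min t (a + 1)} = max 0 (min 1 (t - a))" by (auto simp: min_def max_def)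
  ultimately show ?thesis by (simp only: has_integral_restrict_Int)
qed

text \<open>Each edge takes unit time. Directions are prescribed only inside the edges, as the
  corner times form a null set, whereas the frontier condition includes the corners.\<close>

lemma polygonal_gen_char:
  fixes Z :: "nat \<Rightarrow> R4" and C :: "R4 set"
  assumes n: "0 < n" and cl: "Z n = Z 0" and nc: "k0 \<le> n" "Z k0 \<noteq> Z 0"
    and dir: "\<And>k s. \<lbrakk>k < n; 0 < s; s < 1\<rbrakk> \<Longrightarrow>
      Z (Suc k) - Z k \<in> Jsymp ` normal_cone C ((1 - s) *\<^sub>R Z k + s *\<^sub>R Z (Suc k))"
    and fr: "\<And>k s. \<lbrakk>k < n; 0 \<le> s; s \<le> 1\<rbrakk> \<Longrightarrow> (1 - s) *\<^sub>R Z k + s *\<^sub>R Z (Suc k) \<in> frontier C"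
  obtains z z' where "closed_gen_char C (real n) z z'"
    "action (real n) z z' = (\<Sum>k<n. (- Jsymp (Z (Suc k) - Z k)) \<bullet> Z k) / 2"
proof -
  define D where "D k = Z (Suc k) - Z k" for k
  \<comment> \<open>Each increment is weighted by the clamped time spent on its edge, which is the
    integral of the indicator used in \<open>z'\<close>.\<close>
  define z where "z t = Z 0 + (\<Sum>k<n. max 0 (min 1 (t - real k)) *\<^sub>R D k)" for t
  \<comment> \<open>At an interior integer time the closed intervals overlap and two edges are
    counted; this affects only finitely many times.\<close>
  define z' where "z' t = (\<Sum>k<n. if t \<in> {real k..real k + 1} then D k else 0)" for t
  have zseg: "z t = (1 - (t - real k)) *\<^sub>R Z k + (t - real k) *\<^sub>R Z (Suc k)"
    if k: "k < n" "real k \<le> t" "t \<le> real k + 1" for k t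
  proof -
    have "(\<Sum>j<n. max 0 (min 1 (t - real j)) *\<^sub>R D j) = (\<Sum>j<Suc k. max 0 (min 1 (t - real j)) *\<^sub>R D j)"
      using k by (intro sum.mono_neutral_right) auto
    also have "\<dots> = (\<Sum>j<k. D j) + (t - real k) *\<^sub>R D k"
      using k by (auto intro!: sum.cong)
    also have "(\<Sum>j<k. D j) = Z k - Z 0" unfolding D_def by (rule sum_lessThan_telescope)
    finally show ?thesis unfolding z_def D_def by (simp add: algebra_simps)
  qed
  have z'seg: "z' t = D k" if k: "k < n" "real k < t" "t < real k + 1" for k t
  proof -
    have "z' t = (\<Sum>j<n. if j = k then D k else 0)"
      unfolding z'_def using k by (intro sum.cong) auto
    then show ?thesis using k by simp
  qed
  have floor: "\<exists>k<n. real k < t \<and> t < real k + 1" if t: "t \<in> {0..real n} - real ` {..n}" for t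
  proof (intro exI conjI)
    let ?k = "nat \<lfloor>t\<rfloor>"
    have 1: "real ?k \<le> t" "t < real ?k + 1" using t by (auto simp: of_nat_floor)
    then have "real ?k \<le> real n" using t by auto
    then have "?k \<le> n" by (simp only: of_nat_le_iff)
    then have "t \<noteq> real ?k" using t by (metis DiffD2 atMost_iff imageI)
    then show k: "real ?k < t" using 1 by simp
    then have "real ?k < real n" using t by auto
    then show "?k < n" by (simp only: of_nat_less_iff)
    show "t < real ?k + 1" by fact
  qed
  have negl: "negligible (real ` {..n})" by (intro negligible_finite) simp
  have z0: "z 0 = Z 0" unfolding z_def by simp
  have int: "(z' has_integral z t - z 0) {0..t}" for t
  proof -
    have "(z' has_integral (\<Sum>k<n. max 0 (min 1 (t - real k)) *\<^sub>R D k)) {0..t}"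
      unfolding z'_def by (intro has_integral_sum has_integral_interval_const) auto
    then show ?thesis unfolding z0 by (simp add: z_def)
  qed
  have zk: "z (real k) = Z k" if "k \<le> n" for k
  proof (cases k)
    case 0
    then show ?thesis using z0 by simp
  next
    case (Suc m)
    then show ?thesis using zseg[of m "real k"] that by simp
  qed
  have "closed_gen_char C (real n) z z'"
    unfolding closed_gen_char_def
  proof (intro conjI)
    show "0 < real n" using n by simp
    show "z' absolutely_integrable_on {0..real n}"
      unfolding z'_def
    proof (intro absolutely_integrable_sum)
      fix k
      have "(\<lambda>t. if t \<in> {real k..real k + 1} then D k else 0) integrable_on {0..real n}"
        by (rule has_integral_integrable[OF has_integral_interval_const]) simp
      moreover have "(\<lambda>t. if t \<in> {real k..real k + 1} then norm (D k) else 0) integrable_on {0..real n}"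
        by (rule has_integral_integrable[OF has_integral_interval_const]) simp
      ultimately show "(\<lambda>t. if t \<in> {real k..real k + 1} then D k else 0) absolutely_integrable_on {0..real n}"
        unfolding absolutely_integrable_on_def by (simp add: if_distrib[of norm] cong: if_cong)
    qed simp
    show "\<forall>t\<in>{0..real n}. z t = z 0 + integral {0..t} z'"
    proof
      fix t
      show "z t = z 0 + integral {0..t} z'" unfolding integral_unique[OF int] by simp
    qed
    show "\<exists>N. negligible N \<and> (\<forall>t\<in>{0..real n} - N. z' t \<in> Jsymp ` normal_cone C (z t))"
    proof (intro exI conjI ballI)
      show "negligible (real ` {..n})" by (rule negl)
      fix t assume "t \<in> {0..real n} - real ` {..n}"
      then obtain k where k: "k < n" "real k < t" "t < real k + 1" using floor by blast
      then show "z' t \<in> Jsymp ` normal_cone C (z t)"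
        using dir[of k "t - real k"] zseg[of k t] z'seg[of k t] unfolding D_def by simp
    qed
    show "\<forall>t\<in>{0..real n}. z t \<in> frontier C"
    proof
      fix t assume t: "t \<in> {0..real n}"
      show "z t \<in> frontier C"
      proof (cases "t \<in> real ` {..n}")
        case True
        then obtain k where k: "k \<le> n" "t = real k" by auto
        show ?thesis
        proof (cases "k = n")
          case True
          then have "z t = Z 0" using k zk cl by simp
          then show ?thesis using fr[of 0 0] n by simp
        next
          case False
          then show ?thesis using k zk fr[of k 0] by simp
        qed
      next
        case False
        then obtain k where k: "k < n" "real k < t" "t < real k + 1" using floor t by blast
        then show ?thesis using fr[of k "t - real k"] zseg[of k t] by simp
      qed
    qed
    show "z (real n) = z 0" using zk[of n] z0 cl by simp
    show "\<exists>t\<in>{0..real n}. z t \<noteq> z 0"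
      using nc zk[of k0] z0 by (intro bexI[of _ "real k0"]) auto
  qed
  moreover have "action (real n) z z' = (\<Sum>k<n. (- Jsymp (Z (Suc k) - Z k)) \<bullet> Z k) / 2"
  proof -
    have "integral {0..real n} (\<lambda>t. (- Jsymp (z' t)) \<bullet> z t) =
        integral {0..real n} (\<lambda>t. \<Sum>k<n. if t \<in> {real k..real k + 1} then (- Jsymp (D k)) \<bullet> Z k else 0)"
    proof (rule integral_spike[OF negl])
      fix t assume "t \<in> {0..real n} - real ` {..n}"
      then obtain k where k: "k < n" "real k < t" "t < real k + 1" using floor by blast
      have "(\<Sum>j<n. if t \<in> {real j..real j + 1} then (- Jsymp (D j)) \<bullet> Z j else 0) =
          (\<Sum>j<n. if j = k then (- Jsymp (D k)) \<bullet> Z k else 0)"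
        using k by (intro sum.cong) auto
      also have "\<dots> = (- Jsymp (D k)) \<bullet> Z k" using k by simp
      also have "\<dots> = (- Jsymp (z' t)) \<bullet> z t"
      proof -
        have "z t = Z k + (t - real k) *\<^sub>R D k"
          using zseg[of k t] k unfolding D_def by (simp add: algebra_simps)
        \<comment> \<open>By skew symmetry the integrand is constant along an edge, so it may be
          evaluated at the starting corner.\<close>
        moreover have "Jsymp (D k) \<bullet> D k = 0"
          by (simp add: Jsymp_def inner_prod_def inner_commute)
        ultimately show ?thesis using z'seg[OF k] by (simp add: inner_add_right)
      qed
      finally show "(\<Sum>j<n. if t \<in> {real j..real j + 1} then (- Jsymp (D j)) \<bullet> Z j else 0) =
         (- Jsymp (z' t)) \<bullet> z t" .
    qed
    also have "\<dots> = (\<Sum>k<n. (- Jsymp (D k)) \<bullet> Z k)"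
    proof (rule integral_unique, rule has_integral_sum)
      fix k assume k: "k \<in> {..<n}"
      then have "max 0 (min 1 (real n - real k)) = 1" by auto
      then show "((\<lambda>t. if t \<in> {real k..real k + 1} then (- Jsymp (D k)) \<bullet> Z k else 0)
          has_integral (- Jsymp (D k)) \<bullet> Z k) {0..real n}"
        using has_integral_interval_const[of "real k" "(- Jsymp (D k)) \<bullet> Z k" "real n"] by simp
    qed simp
    finally show ?thesis unfolding action_def D_def by simp
  qed
  ultimately show thesis using that by blast
qed

section \<open>Shortest loops that do not fit\<close>

text \<open>Vertices may coincide; a segment run to and fro is a loop with a repeated
  vertex.\<close>

definition loop_qlength :: "R2 set \<Rightarrow> R2 \<Rightarrow> R2 \<Rightarrow> R2 \<Rightarrow> real" where
  "loop_qlength Q a b c = qnorm Q (b - a) + qnorm Q (c - b) + qnorm Q (a - c)"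

text \<open>With the interior in place of \<open>K\<close> this is a closed condition on triples.
  The price is that the fit of a minimiser into \<open>K\<close> itself needs a separate
  argument.\<close>

definition misses :: "R2 set \<Rightarrow> R2 \<Rightarrow> R2 \<Rightarrow> R2 \<Rightarrow> bool" where
  "misses K a b c \<longleftrightarrow> (\<forall>t. \<not> (a + t \<in> interior K \<and> b + t \<in> interior K \<and> c + t \<in> interior K))"

lemma misses_translate: "misses K (a + s) (b + s) (c + s) \<longleftrightarrow> misses K a b c"
proof -
  have "misses K (a + s) (b + s) (c + s)" if "misses K a b c" for a b c s
    using that unfolding misses_def by (simp add: add.assoc)
  from this[of a b c] this[of "a + s" "b + s" "c + s" "- s"] show ?thesis by auto
qed

lemma loop_qlength_translate: "loop_qlength Q (a + s) (b + s) (c + s) = loop_qlength Q a b c"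
  unfolding loop_qlength_def by simp

lemma loop_qlength_scaleR:
  assumes "compact Q" "Q \<noteq> {}" "0 \<le> l"
  shows "loop_qlength Q (l *\<^sub>R a) (l *\<^sub>R b) (l *\<^sub>R c) = l * loop_qlength Q a b c"
  unfolding loop_qlength_def
  by (simp only: scaleR_diff_right[symmetric] qnorm_scaleR[OF assms] distrib_left)

text \<open>The product of three interiors is separated from the plane of all translates of
  \<open>(a, b, c)\<close>. A functional bounded below on that plane is constant on it, hence the
  vanishing sum.\<close>

lemma misses_separation:
  assumes K: "convex_shape K" and m: "misses K a b c"
  obtains m1 m2 m3 where "m1 + m2 + m3 = 0" "(m1, m2, m3) \<noteq> 0"
    "\<And>x y w. \<lbrakk>x \<in> K; y \<in> K; w \<in> K\<rbrakk> \<Longrightarrow> m1 \<bullet> x + m2 \<bullet> y + m3 \<bullet> w \<le> m1 \<bullet> a + m2 \<bullet> b + m3 \<bullet> c"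
proof -
  have Kp: "compact K" "convex K" "interior K \<noteq> {}" using K unfolding convex_shape_def by auto
  have cl: "closure (interior K) = K"
    using Kp convex_closure_interior compact_imp_closed closure_closed by metis
  define S where "S = interior K \<times> interior K \<times> interior K"
  define R where "R = range (\<lambda>t. (a + t, b + t, c + t))"
  have "R = (+) (a, b, c) ` range (\<lambda>t. (t, t, t))" unfolding R_def by (simp add: image_image)
  moreover have "linear (\<lambda>t::R2. (t, t, t))" by (intro linearI) auto
  ultimately have cR: "convex R"
    by (simp add: convex_translation convex_linear_image)
  have "\<exists>A \<beta>. A \<noteq> 0 \<and> (\<forall>x\<in>S. A \<bullet> x \<le> \<beta>) \<and> (\<forall>x\<in>R. \<beta> \<le> A \<bullet> x)"
  proof (rule separating_hyperplane_sets[OF _ cR])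
    show "convex S" unfolding S_def using Kp by (intro convex_Times convex_interior)
    show "S \<noteq> {}" unfolding S_def using Kp by auto
    show "R \<noteq> {}" unfolding R_def by auto
    show "S \<inter> R = {}" using m unfolding S_def R_def misses_def by auto
  qed
  then obtain A' \<beta> where A': "A' \<noteq> 0" "\<forall>x\<in>S. A' \<bullet> x \<le> \<beta>" "\<forall>x\<in>R. \<beta> \<le> A' \<bullet> x" by blast
  obtain m1 m2 m3 where "A' = (m1, m2, m3)" by (rule prod_cases3)
  note A = A'[unfolded this]
  have line: "\<beta> \<le> m1 \<bullet> a + m2 \<bullet> b + m3 \<bullet> c + (m1 + m2 + m3) \<bullet> t" for t
  proof -
    have "\<beta> \<le> (m1, m2, m3) \<bullet> (a + t, b + t, c + t)" by (rule bspec[OF A(3)]) (simp add: R_def)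
    then show ?thesis by (simp add: inner_add_left inner_add_right)
  qed
  define v where "v = m1 + m2 + m3"
  define H where "H = m1 \<bullet> a + m2 \<bullet> b + m3 \<bullet> c"
  \<comment> \<open>Otherwise a translation along \<open>v\<close> drives the functional below
    \<open>\<beta>\<close>; the multiple chosen yields exactly \<open>\<beta> - 1\<close>.\<close>
  have "v = 0"
  proof (rule ccontr)
    assume "v \<noteq> 0"
    then have "v \<bullet> ((- (H - \<beta> + 1) / (v \<bullet> v)) *\<^sub>R v) = - (H - \<beta> + 1)" by simp
    then show False using line[of "(- (H - \<beta> + 1) / (v \<bullet> v)) *\<^sub>R v"] unfolding v_def[symmetric] H_def[symmetric]
      by linarith
  qed
  have "\<beta> \<le> H" using line[of 0] unfolding H_def by simp
  have "K \<times> K \<times> K = closure S" unfolding S_def closure_Times cl ..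
  moreover have "closure S \<subseteq> {x. (m1, m2, m3) \<bullet> x \<le> \<beta>}"
    using A(2) by (intro closure_minimal closed_halfspace_le) auto
  ultimately have "m1 \<bullet> x + m2 \<bullet> y + m3 \<bullet> w \<le> H" if "x \<in> K" "y \<in> K" "w \<in> K" for x y w
    using that \<open>\<beta> \<le> H\<close> by (force simp: subset_iff)
  with that \<open>v = 0\<close> A(1) show thesis unfolding v_def H_def by blast
qed

text \<open>If some translate were interior, each vertex could be pushed slightly along its own
  \<open>m1\<close>, \<open>m2\<close>, \<open>m3\<close>, which raises the functional above its
  bound; the translation itself is invisible because the sum is 0.\<close>

lemma misses_criterion:
  assumes m: "m1 + m2 + m3 = 0" "(m1, m2, m3) \<noteq> (0::R2 \<times> R2 \<times> R2)"
    and le: "\<And>x y w. \<lbrakk>x \<in> K; y \<in> K; w \<in> K\<rbrakk> \<Longrightarrow> m1 \<bullet> x + m2 \<bullet> y + m3 \<bullet> w \<le> m1 \<bullet> a + m2 \<bullet> b + m3 \<bullet> c"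
  shows "misses K a b c"
  unfolding misses_def
proof (intro allI notI, elim conjE)
  fix t assume i: "a + t \<in> interior K" "b + t \<in> interior K" "c + t \<in> interior K"
  have "\<exists>d>0. \<forall>e. 0 < e \<and> e \<le> d \<longrightarrow> x + e *\<^sub>R v \<in> K" if x: "x \<in> interior K" for x v
  proof -
    obtain r where r: "0 < r" "cball x r \<subseteq> K" using x by (meson mem_interior_cball)
    have "x + e *\<^sub>R v \<in> K" if "0 < e" "e \<le> r / (norm v + 1)" for e
    proof (rule subsetD[OF r(2)])
      have "e * norm v \<le> e * (norm v + 1)" using that by simp
      also have "\<dots> \<le> r" using that by (simp add: field_simps add_pos_nonneg)
      finally show "x + e *\<^sub>R v \<in> cball x r" using that by (simp add: dist_norm)
    qed
    then show ?thesis using r by (intro exI[of _ "r / (norm v + 1)"]) (auto simp: add_nonneg_pos)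
  qed
  then obtain d1 d2 d3 where d: "0 < d1" "0 < d2" "0 < d3"
      "\<And>e. 0 < e \<Longrightarrow> e \<le> d1 \<Longrightarrow> a + t + e *\<^sub>R m1 \<in> K"
      "\<And>e. 0 < e \<Longrightarrow> e \<le> d2 \<Longrightarrow> b + t + e *\<^sub>R m2 \<in> K"
      "\<And>e. 0 < e \<Longrightarrow> e \<le> d3 \<Longrightarrow> c + t + e *\<^sub>R m3 \<in> K"
    using i by metis
  define e where "e = min d1 (min d2 d3)"
  have e: "0 < e" "e \<le> d1" "e \<le> d2" "e \<le> d3" unfolding e_def using d by auto
  have "m1 \<bullet> (a + t + e *\<^sub>R m1) + m2 \<bullet> (b + t + e *\<^sub>R m2) + m3 \<bullet> (c + t + e *\<^sub>R m3)
      \<le> m1 \<bullet> a + m2 \<bullet> b + m3 \<bullet> c"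
    using e d by (intro le) auto
  moreover have "m1 \<bullet> t + m2 \<bullet> t + m3 \<bullet> t = 0"
    using m(1) by (metis inner_add_left inner_zero_left)
  ultimately have "e * (m1 \<bullet> m1 + m2 \<bullet> m2 + m3 \<bullet> m3) \<le> 0"
    by (simp add: inner_add_right algebra_simps)
  then have "m1 \<bullet> m1 + m2 \<bullet> m2 + m3 \<bullet> m3 \<le> 0" using e by (simp add: mult_le_0_iff)
  then have "m1 \<bullet> m1 = 0 \<and> m2 \<bullet> m2 = 0 \<and> m3 \<bullet> m3 = 0"
    using inner_ge_zero[of m1] inner_ge_zero[of m2] inner_ge_zero[of m3] by linarith
  then show False using m(2) by (simp add: zero_prod_def)
qed

text \<open>The linear terms in \<open>y\<close> cancel because the edges sum to 0. This gives
  nonnegativity and coercivity of the length.\<close>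

lemma loop_qlength_ge:
  assumes "compact Q" "cball y r \<subseteq> Q" "0 \<le> r"
  shows "r * (norm (b - a) + norm (c - b) + norm (a - c)) \<le> loop_qlength Q a b c"
proof -
  have "((b - a) \<bullet> y + r * norm (b - a)) + ((c - b) \<bullet> y + r * norm (c - b)) + ((a - c) \<bullet> y + r * norm (a - c))
      \<le> loop_qlength Q a b c"
    unfolding loop_qlength_def by (intro add_mono qnorm_ge_cball[OF assms])
  then show ?thesis by (simp add: inner_diff_left algebra_simps)
qed

lemma continuous_on_qnorm:
  assumes "compact Q" "Q \<noteq> {}"
  shows "continuous_on UNIV (qnorm Q)"
proof (rule convex_on_continuous)
  show "convex_on UNIV (qnorm Q)"
  proof (rule convex_onI)
    fix t :: real and x y assume t: "0 < t" "t < 1"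
    have "qnorm Q ((1 - t) *\<^sub>R x + t *\<^sub>R y) \<le> qnorm Q ((1 - t) *\<^sub>R x) + qnorm Q (t *\<^sub>R y)"
      by (rule qnorm_add[OF assms])
    then show "qnorm Q ((1 - t) *\<^sub>R x + t *\<^sub>R y) \<le> (1 - t) * qnorm Q x + t * qnorm Q y"
      using t by (simp add: qnorm_scaleR[OF assms])
  qed simp
qed simp

text \<open>Translation moves the first vertex to 0, after which the length controls the other two.
  The given triple makes the sublevel set nonempty.\<close>

lemma minimal_loop:
  assumes Q: "convex_polygon Q" and m0: "misses K a0 b0 c0"
  obtains b c where "misses K 0 b c"
    "\<And>x y w. misses K x y w \<Longrightarrow> loop_qlength Q 0 b c \<le> loop_qlength Q x y w"
proof -
  note Qp = convex_polygonD[OF Q]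
  obtain y0 r where r: "0 < r" "cball y0 r \<subseteq> Q" using interior_cballE Qp(5) by blast
  define L where "L p = loop_qlength Q 0 (fst p) (snd p)" for p
  have Lc: "continuous_on UNIV L"
    unfolding L_def loop_qlength_def
    by (intro continuous_intros continuous_on_compose2[OF continuous_on_qnorm[OF Qp(2,4)]]) auto
  define C where "C = L (b0 - a0, c0 - a0)"
  define X where "X = {p. misses K 0 (fst p) (snd p)} \<inter> {p. L p \<le> C}"
  have tr: "misses K 0 (y - x) (w - x)" "L (y - x, w - x) = loop_qlength Q x y w" if "misses K x y w" for x y w
    using that misses_translate[of K x "- x" y w] loop_qlength_translate[of Q x "- x" y w]
    unfolding L_def by auto
  \<comment> \<open>The complement is a union of products of translated open sets, one for each
    position \<open>t\<close> of the first vertex.\<close>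
  have "- {p. misses K 0 (fst p) (snd p)} =
      (\<Union>t\<in>interior K. (\<lambda>x. - t + x) ` interior K \<times> (\<lambda>x. - t + x) ` interior K)" (is "_ = ?U")
  proof (intro set_eqI iffI)
    fix p assume "p \<in> - {p. misses K 0 (fst p) (snd p)}"
    then obtain t where t: "t \<in> interior K" "fst p + t \<in> interior K" "snd p + t \<in> interior K"
      unfolding misses_def by auto
    have "fst p \<in> (\<lambda>x. - t + x) ` interior K" "snd p \<in> (\<lambda>x. - t + x) ` interior K"
      using t by (auto intro!: image_eqI[of _ _ "_ + t"])
    then show "p \<in> ?U" using t(1) by (intro UN_I[of t]) (simp_all add: mem_Times_iff)
  next
    fix p assume "p \<in> ?U"
    then obtain t x y where "t \<in> interior K" "x \<in> interior K" "y \<in> interior K" "p = (- t + x, - t + y)"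
      by auto
    then show "p \<in> - {p. misses K 0 (fst p) (snd p)}" by (auto simp: misses_def intro!: exI[of _ t])
  qed
  moreover have "open ?U"
    by (intro open_UN ballI open_Times open_translation open_interior)
  ultimately have "closed {p. misses K 0 (fst p) (snd p)}" by (simp add: closed_def)
  moreover have "closed {p. L p \<le> C}"
    using continuous_on_closed_Collect_le[OF Lc continuous_on_const closed_UNIV, of C] by simp
  ultimately have clX: "closed X" unfolding X_def by blast
  have "norm p \<le> C / r" if "p \<in> X" for p
  proof -
    have "r * (norm (fst p) + norm (snd p - fst p) + norm (snd p)) \<le> C"
      using loop_qlength_ge[OF Qp(2) r(2), of "fst p" 0 "snd p"] r(1) that unfolding X_def L_def by simp
    moreover have "norm p \<le> norm (fst p) + norm (snd p)"
      using norm_Pair_le[of "fst p" "snd p"] by simp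
    then have "r * norm p \<le> r * (norm (fst p) + norm (snd p - fst p) + norm (snd p))"
      using r(1) by (intro mult_left_mono) (auto intro: order_trans)
    ultimately show ?thesis using r(1) by (simp add: field_simps)
  qed
  then have "bounded X" unfolding bounded_iff by blast
  then have "compact X" using clX compact_eq_bounded_closed by blast
  moreover have X0: "(b0 - a0, c0 - a0) \<in> X" unfolding X_def C_def using tr[OF m0] by simp
  ultimately obtain p where p: "p \<in> X" "\<forall>s\<in>X. L p \<le> L s"
    using continuous_attains_inf[of X L] continuous_on_subset[OF Lc] by blast
  show thesis
  proof (rule that)
    show "misses K 0 (fst p) (snd p)" using p unfolding X_def by simp
    fix x y w assume m: "misses K x y w"
    show "loop_qlength Q 0 (fst p) (snd p) \<le> loop_qlength Q x y w"
    proof (cases "loop_qlength Q x y w \<le> C")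
      case True
      then have "(y - x, w - x) \<in> X" unfolding X_def using tr[OF m] by simp
      then show ?thesis using p(2) tr[OF m] unfolding L_def by fastforce
    next
      case False
      then show ?thesis using p(1) unfolding X_def L_def by simp
    qed
  qed
qed

lemma misses_loop_qlength_pos:
  assumes Q: "convex_polygon Q" and K: "convex_shape K" and m: "misses K a b c"
  shows "0 < loop_qlength Q a b c" "\<not> (a = b \<and> b = c)"
proof -
  note Qp = convex_polygonD[OF Q]
  obtain y0 r where r: "0 < r" "cball y0 r \<subseteq> Q" using interior_cballE Qp(5) by blast
  obtain x where x: "x \<in> interior K" using K unfolding convex_shape_def by auto
  show ne: "\<not> (a = b \<and> b = c)"
  proof
    assume "a = b \<and> b = c"
    then have "a + (x - a) \<in> interior K \<and> b + (x - a) \<in> interior K \<and> c + (x - a) \<in> interior K"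
      using x by simp
    then show False using m unfolding misses_def by blast
  qed
  then have "0 < norm (b - a) + norm (c - b) + norm (a - c)"
    by (metis add_nonneg_eq_0_iff add_nonneg_nonneg eq_iff_diff_eq_0 norm_eq_zero norm_ge_zero order_le_less)
  then have "0 < r * (norm (b - a) + norm (c - b) + norm (a - c))" using r by simp
  then show "0 < loop_qlength Q a b c"
    using loop_qlength_ge[OF Qp(2) r(2), of b a c] r by simp
qed

text \<open>Copies scaled by a factor in \<open>{0<..<1}\<close> are shorter, so they do not miss
  the interior. The factors whose copy fits into \<open>K\<close> form a closed set, which thus
  contains 1.\<close>

lemma minimal_loop_fits:
  assumes Q: "convex_polygon Q" and K: "convex_shape K" and m: "misses K a b c"
    and min: "\<And>x y w. misses K x y w \<Longrightarrow> loop_qlength Q a b c \<le> loop_qlength Q x y w"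
  shows "\<exists>t. a + t \<in> K \<and> b + t \<in> K \<and> c + t \<in> K"
proof -
  note Qp = convex_polygonD[OF Q]
  have Kp: "compact K" using K unfolding convex_shape_def by auto
  \<comment> \<open>Fitting triples are the sums of the compact
    \<open>K \<times> K \<times> K\<close> and the closed diagonal, hence a closed set.\<close>
  define V :: "(R2 \<times> R2 \<times> R2) set" where "V = {v. fst v = fst (snd v) \<and> fst v = snd (snd v)}"
  define S where "S = (\<Union>u\<in>K \<times> K \<times> K. \<Union>v\<in>V. {u + v})"
  have "closed V" unfolding V_def
    by (intro closed_Collect_conj closed_Collect_eq continuous_intros)
  then have S: "closed S" unfolding S_def
    using compact_closed_sums[of "K \<times> K \<times> K" V] Kp by (simp add: compact_Times)
  have Siff: "(x, y, w) \<in> S \<longleftrightarrow> (\<exists>t. x + t \<in> K \<and> y + t \<in> K \<and> w + t \<in> K)" for x y w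
  proof
    assume "(x, y, w) \<in> S"
    then obtain u1 u2 u3 s where "u1 \<in> K" "u2 \<in> K" "u3 \<in> K" "x = u1 + s" "y = u2 + s" "w = u3 + s"
      unfolding S_def V_def by auto
    then have "x + (- s) \<in> K \<and> y + (- s) \<in> K \<and> w + (- s) \<in> K" by simp
    then show "\<exists>t. x + t \<in> K \<and> y + t \<in> K \<and> w + t \<in> K" by blast
  next
    assume "\<exists>t. x + t \<in> K \<and> y + t \<in> K \<and> w + t \<in> K"
    then obtain t where t: "x + t \<in> K" "y + t \<in> K" "w + t \<in> K" by blast
    show "(x, y, w) \<in> S" unfolding S_def
      by (rule UN_I[of "(x + t, y + t, w + t)"], use t in simp, rule UN_I[of "(- t, - t, - t)"])
        (simp_all add: V_def)
  qed
  define A where "A = {l. l *\<^sub>R (a, b, c) \<in> S}"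
  have "closed A"
    unfolding A_def using S by (intro closed_vimage[unfolded vimage_def] continuous_intros)
  moreover have "{0<..<1} \<subseteq> A"
  proof
    fix l :: real assume l: "l \<in> {0<..<1}"
    have "loop_qlength Q (l *\<^sub>R a) (l *\<^sub>R b) (l *\<^sub>R c) < loop_qlength Q a b c"
      using loop_qlength_scaleR[OF Qp(2,4), of l a b c] misses_loop_qlength_pos(1)[OF Q K m] l by simp
    then have "\<not> misses K (l *\<^sub>R a) (l *\<^sub>R b) (l *\<^sub>R c)" using min leD by blast
    then obtain t where "l *\<^sub>R a + t \<in> interior K" "l *\<^sub>R b + t \<in> interior K" "l *\<^sub>R c + t \<in> interior K"
      unfolding misses_def by blast
    then have "l *\<^sub>R a + t \<in> K" "l *\<^sub>R b + t \<in> K" "l *\<^sub>R c + t \<in> K"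
      using interior_subset by blast+
    then show "l \<in> A" unfolding A_def using Siff by auto
  qed
  ultimately have "closure {0<..<1::real} \<subseteq> A" by (intro closure_minimal)
  then have "1 \<in> A" by auto
  then show ?thesis unfolding A_def using Siff by simp
qed

section \<open>Characteristics along shortest loops\<close>

text \<open>Here \<open>f\<close> is the adjoint of the map from vertices to edges, so the length is
  the support function of the compact convex set \<open>D\<close>; whatever it dominates lies in
  \<open>D\<close>.\<close>

lemma loop_qlength_dominated:
  assumes Q: "compact Q" "convex Q" "Q \<noteq> {}"
    and le: "\<And>x y w. m1 \<bullet> x + m2 \<bullet> y + m3 \<bullet> w \<le> loop_qlength Q x y w"
  obtains p1 p2 p3 where "p1 \<in> Q" "p2 \<in> Q" "p3 \<in> Q" "m1 = p3 - p1" "m2 = p1 - p2" "m3 = p2 - p3"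
proof -
  define f :: "R2 \<times> R2 \<times> R2 \<Rightarrow> R2 \<times> R2 \<times> R2"
    where "f = (\<lambda>p. (snd (snd p) - fst p, fst p - fst (snd p), fst (snd p) - snd (snd p)))"
  define D where "D = f ` (Q \<times> Q \<times> Q)"
  have "linear f" unfolding f_def by (intro linearI) (auto simp: algebra_simps)
  then have cD: "convex D" unfolding D_def using Q by (intro convex_linear_image convex_Times)
  have "continuous_on (Q \<times> Q \<times> Q) f" unfolding f_def by (intro continuous_intros)
  then have kD: "closed D" unfolding D_def using Q
    by (intro compact_imp_closed compact_continuous_image compact_Times)
  have "(m1, m2, m3) \<in> D"
  proof (rule ccontr)
    assume "(m1, m2, m3) \<notin> D"
    then obtain A \<beta> where A: "A \<bullet> (m1, m2, m3) < \<beta>" "\<forall>d\<in>D. \<beta> < A \<bullet> d"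
      using separating_hyperplane_closed_point[OF cD kD] by blast
    obtain a b c where abc: "A = (a, b, c)" by (rule prod_cases3)
    \<comment> \<open>Separation bounds \<open>A\<close> on \<open>D\<close> from below while the
      length is a maximum, so the test loop has the negated components of \<open>A\<close> as
      vertices.\<close>
    obtain p1 where p1: "p1 \<in> Q" "qnorm Q (- b - - a) = (- b - - a) \<bullet> p1" using qnorm_attained Q by blast
    obtain p2 where p2: "p2 \<in> Q" "qnorm Q (- c - - b) = (- c - - b) \<bullet> p2" using qnorm_attained Q by blast
    obtain p3 where p3: "p3 \<in> Q" "qnorm Q (- a - - c) = (- a - - c) \<bullet> p3" using qnorm_attained Q by blast
    have "f (p1, p2, p3) \<in> D" unfolding D_def using p1 p2 p3 by blast
    then have "\<beta> < A \<bullet> f (p1, p2, p3)" using A(2) by blast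
    moreover have "loop_qlength Q (- a) (- b) (- c) = - (A \<bullet> f (p1, p2, p3))"
      unfolding loop_qlength_def p1(2) p2(2) p3(2) abc f_def
      by (simp add: inner_diff_left inner_diff_right inner_commute)
    ultimately show False
      using le[of "- a" "- b" "- c"] A(1) unfolding abc by (simp add: inner_commute)
  qed
  then show thesis using that unfolding D_def f_def by auto
qed

lemma frontier_normal_cone:
  assumes "z \<in> C" "n \<in> normal_cone C z" "n \<noteq> 0"
  shows "z \<in> frontier C"
proof -
  have "z \<notin> interior C"
  proof
    assume "z \<in> interior C"
    then obtain e where e: "0 < e" "cball z e \<subseteq> C" by (meson mem_interior_cball)
    let ?y = "z + (e / norm n) *\<^sub>R n"
    have "?y \<in> C" using e assms(3) by (intro subsetD[OF e(2)]) (simp add: dist_norm)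
    then have "n \<bullet> (?y - z) \<le> 0" using assms(2) unfolding normal_cone_def by blast
    then have "(e / norm n) * (n \<bullet> n) \<le> 0" by simp
    moreover have "0 < (e / norm n) * (n \<bullet> n)" using e assms(3) by simp
    ultimately show False by simp
  qed
  then show ?thesis using assms(1) closure_subset unfolding frontier_def by blast
qed

lemma normal_cone_fst:
  assumes "\<And>y. y \<in> K \<Longrightarrow> n \<bullet> y \<le> n \<bullet> x"
  shows "(n, 0) \<in> normal_cone (K \<times> Q) (x, p)"
  using assms unfolding normal_cone_def by (auto simp: inner_diff_right)

lemma normal_cone_snd:
  assumes "\<And>y. y \<in> Q \<Longrightarrow> v \<bullet> y \<le> v \<bullet> p"
  shows "(0, v) \<in> normal_cone (K \<times> Q) (x, p)"
  using assms unfolding normal_cone_def by (auto simp: inner_diff_right)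

text \<open>The position rests at \<open>x\<close> while the momentum runs from \<open>p\<close> to
  \<open>p'\<close>. If the two agree, the nonzero normal must come from an adjacent edge
  \<open>v\<close> or \<open>v'\<close>.\<close>

lemma bounce_frontier:
  fixes K Q :: "R2 set"
  assumes x: "x \<in> K" and p: "convex Q" "p \<in> Q" "p' \<in> Q"
    and n: "\<And>y. y \<in> K \<Longrightarrow> (p - p') \<bullet> y \<le> (p - p') \<bullet> x"
    and v: "\<And>y. y \<in> Q \<Longrightarrow> v \<bullet> y \<le> v \<bullet> p" "\<And>y. y \<in> Q \<Longrightarrow> v' \<bullet> y \<le> v' \<bullet> p'" "v \<noteq> 0 \<or> v' \<noteq> 0"
    and s: "0 \<le> s" "s \<le> 1"
  shows "(x, (1 - s) *\<^sub>R p + s *\<^sub>R p') \<in> frontier (K \<times> Q)"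
proof -
  have m: "(x, (1 - s) *\<^sub>R p + s *\<^sub>R p') \<in> K \<times> Q"
    using x p s by (auto intro!: convexD)
  show ?thesis
  proof (cases "p = p'")
    case True
    then have e: "(1 - s) *\<^sub>R p + s *\<^sub>R p' = p" by (simp flip: scaleR_add_left)
    show ?thesis
    proof (cases "v = 0")
      case True
      then show ?thesis
        using frontier_normal_cone[OF m[unfolded e] normal_cone_snd[of Q v']] v \<open>p = p'\<close>
        unfolding e by (simp add: zero_prod_def)
    next
      case False
      then show ?thesis
        using frontier_normal_cone[OF m[unfolded e] normal_cone_snd[of Q v]] v
        unfolding e by (simp add: zero_prod_def)
    qed
  next
    case False
    then show ?thesis
      using frontier_normal_cone[OF m normal_cone_fst[of K "p - p'"]] n by (simp add: zero_prod_def)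
  qed
qed

text \<open>The momentum rests while the position moves. A degenerate edge supplies no normal of its
  own, so the frontier condition at its start is assumed.\<close>

lemma glide_frontier:
  fixes K Q :: "R2 set"
  assumes x: "convex K" "x \<in> K" "x' \<in> K" and p: "p \<in> Q"
    and v: "\<And>y. y \<in> Q \<Longrightarrow> (x' - x) \<bullet> y \<le> (x' - x) \<bullet> p" and f: "(x, p) \<in> frontier (K \<times> Q)"
    and s: "0 \<le> s" "s \<le> 1"
  shows "((1 - s) *\<^sub>R x + s *\<^sub>R x', p) \<in> frontier (K \<times> Q)"
proof (cases "x' = x")
  case True
  then show ?thesis using f by (simp flip: scaleR_add_left)
next
  case False
  have "((1 - s) *\<^sub>R x + s *\<^sub>R x', p) \<in> K \<times> Q"
    using x p s by (auto intro!: convexD)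
  then show ?thesis
    using frontier_normal_cone[OF _ normal_cone_snd[of Q "x' - x"]] v False by (simp add: zero_prod_def)
qed

lemma closed_billiard_gen_char:
  assumes K: "convex K" "a \<in> K" "b \<in> K" "c \<in> K" and Q: "convex Q" "p1 \<in> Q" "p2 \<in> Q" "p3 \<in> Q"
    and na: "\<And>y. y \<in> K \<Longrightarrow> (p3 - p1) \<bullet> y \<le> (p3 - p1) \<bullet> a"
    and nb: "\<And>y. y \<in> K \<Longrightarrow> (p1 - p2) \<bullet> y \<le> (p1 - p2) \<bullet> b"
    and nc: "\<And>y. y \<in> K \<Longrightarrow> (p2 - p3) \<bullet> y \<le> (p2 - p3) \<bullet> c"
    and v1: "\<And>y. y \<in> Q \<Longrightarrow> (b - a) \<bullet> y \<le> (b - a) \<bullet> p1"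
    and v2: "\<And>y. y \<in> Q \<Longrightarrow> (c - b) \<bullet> y \<le> (c - b) \<bullet> p2"
    and v3: "\<And>y. y \<in> Q \<Longrightarrow> (a - c) \<bullet> y \<le> (a - c) \<bullet> p3"
    and ne: "\<not> (a = b \<and> b = c)"
  obtains T z z' where "closed_gen_char (K \<times> Q) T z z'"
    "action T z z' = (b - a) \<bullet> p1 + (c - b) \<bullet> p2 + (a - c) \<bullet> p3"
proof -
  \<comment> \<open>Bounces and glides alternate, starting with the bounce at \<open>a\<close> out
    of the final momentum \<open>p3\<close>. Coinciding corners give stationary pieces, which the
    zero normal permits.\<close>
  define Z :: "nat \<Rightarrow> R4" where
    "Z k = [(a, p3), (a, p1), (b, p1), (b, p2), (c, p2), (c, p3), (a, p3)] ! k" for k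
  have Zs: "Z 0 = (a, p3)" "Z 1 = (a, p1)" "Z 2 = (b, p1)" "Z 3 = (b, p2)" "Z 4 = (c, p2)" "Z 5 = (c, p3)"
      "Z 6 = (a, p3)" unfolding Z_def by simp_all
  have ZS: "Z (Suc 0) = (a, p1)" "Z (Suc 1) = (b, p1)" "Z (Suc 2) = (b, p2)" "Z (Suc 3) = (c, p2)"
      "Z (Suc 4) = (c, p3)" "Z (Suc 5) = (a, p3)" unfolding Z_def by simp_all
  have six: "k = 0 \<or> k = 1 \<or> k = 2 \<or> k = 3 \<or> k = 4 \<or> k = 5" if "k < 6" for k :: nat
    using that by linarith
  have Jp: "(x, p') - (x, p) \<in> Jsymp ` normal_cone (K \<times> Q) ((1 - s) *\<^sub>R (x, p) + s *\<^sub>R (x, p'))"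
    if "\<And>y. y \<in> K \<Longrightarrow> (p - p') \<bullet> y \<le> (p - p') \<bullet> x" for x p p' s
  proof (rule image_eqI)
    show "(x, p') - (x, p) = Jsymp (p - p', 0)" by (simp add: Jsymp_def)
    have "(1 - s) *\<^sub>R (x, p) + s *\<^sub>R (x, p') = (x, (1 - s) *\<^sub>R p + s *\<^sub>R p')"
      by (simp flip: scaleR_add_left)
    then show "(p - p', 0) \<in> normal_cone (K \<times> Q) ((1 - s) *\<^sub>R (x, p) + s *\<^sub>R (x, p'))"
      using normal_cone_fst[OF that] by simp
  qed
  have Jq: "(x', p) - (x, p) \<in> Jsymp ` normal_cone (K \<times> Q) ((1 - s) *\<^sub>R (x, p) + s *\<^sub>R (x', p))"
    if "\<And>y. y \<in> Q \<Longrightarrow> (x' - x) \<bullet> y \<le> (x' - x) \<bullet> p" for x x' p s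
  proof (rule image_eqI)
    show "(x', p) - (x, p) = Jsymp (0, x' - x)" by (simp add: Jsymp_def)
    have "(1 - s) *\<^sub>R (x, p) + s *\<^sub>R (x', p) = ((1 - s) *\<^sub>R x + s *\<^sub>R x', p)"
      by (simp flip: scaleR_add_left)
    then show "(0, x' - x) \<in> normal_cone (K \<times> Q) ((1 - s) *\<^sub>R (x, p) + s *\<^sub>R (x', p))"
      using normal_cone_snd[OF that] by simp
  qed
  have Fa: "(a, (1 - s) *\<^sub>R p3 + s *\<^sub>R p1) \<in> frontier (K \<times> Q)" if "0 \<le> s" "s \<le> 1" for s
    by (rule bounce_frontier[OF K(2) Q(1,4,2) na v3 v1 _ that]) (use ne in auto)
  have Fb: "(b, (1 - s) *\<^sub>R p1 + s *\<^sub>R p2) \<in> frontier (K \<times> Q)" if "0 \<le> s" "s \<le> 1" for s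
    by (rule bounce_frontier[OF K(3) Q(1,2,3) nb v1 v2 _ that]) (use ne in auto)
  have Fc: "(c, (1 - s) *\<^sub>R p2 + s *\<^sub>R p3) \<in> frontier (K \<times> Q)" if "0 \<le> s" "s \<le> 1" for s
    by (rule bounce_frontier[OF K(4) Q(1,3,4) nc v2 v3 _ that]) (use ne in auto)
  have G1: "((1 - s) *\<^sub>R a + s *\<^sub>R b, p1) \<in> frontier (K \<times> Q)" if "0 \<le> s" "s \<le> 1" for s
    by (rule glide_frontier[OF K(1,2,3) Q(2) v1 _ that]) (use Fa[of 1] in auto)
  have G2: "((1 - s) *\<^sub>R b + s *\<^sub>R c, p2) \<in> frontier (K \<times> Q)" if "0 \<le> s" "s \<le> 1" for s
    by (rule glide_frontier[OF K(1,3,4) Q(3) v2 _ that]) (use Fb[of 1] in auto)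
  have G3: "((1 - s) *\<^sub>R c + s *\<^sub>R a, p3) \<in> frontier (K \<times> Q)" if "0 \<le> s" "s \<le> 1" for s
    by (rule glide_frontier[OF K(1,4,2) Q(4) v3 _ that]) (use Fc[of 1] in auto)
  have comb: "(1 - s) *\<^sub>R x + s *\<^sub>R x = x" for s and x :: R2
    by (simp flip: scaleR_add_left)
  \<comment> \<open>Corners 0, 2 and 4 have positions \<open>a\<close>, \<open>b\<close>,
    \<open>c\<close>, which are not all equal.\<close>
  have "\<exists>k0\<le>6. Z k0 \<noteq> Z 0"
  proof (rule ccontr)
    assume "\<not> ?thesis"
    then have "\<forall>k\<le>6. Z k = Z 0" by blast
    from this[rule_format, of 2] this[rule_format, of 4] have "Z 2 = Z 0" "Z 4 = Z 0" by simp_all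
    then show False using ne unfolding Zs by simp
  qed
  then obtain k0 where k0: "k0 \<le> 6" "Z k0 \<noteq> Z 0" by blast
  obtain z z' where z: "closed_gen_char (K \<times> Q) (real 6) z z'"
    "action (real 6) z z' = (\<Sum>k<6. (- Jsymp (Z (Suc k) - Z k)) \<bullet> Z k) / 2"
  proof (rule polygonal_gen_char[OF _ _ k0])
    fix k :: nat and s :: real assume k: "k < 6" and s: "0 < s" "s < 1"
    show "Z (Suc k) - Z k \<in> Jsymp ` normal_cone (K \<times> Q) ((1 - s) *\<^sub>R Z k + s *\<^sub>R Z (Suc k))"
      using six[OF k]
      by (elim disjE) (simp_all only: Zs ZS Jp[OF na] Jp[OF nb] Jp[OF nc] Jq[OF v1] Jq[OF v2] Jq[OF v3])
  next
    fix k :: nat and s :: real assume k: "k < 6" and s: "0 \<le> s" "s \<le> 1"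
    show "(1 - s) *\<^sub>R Z k + s *\<^sub>R Z (Suc k) \<in> frontier (K \<times> Q)"
      using six[OF k]
      by (elim disjE) (simp_all only: Zs ZS scaleR_Pair add_Pair comb
          Fa[OF s] Fb[OF s] Fc[OF s] G1[OF s] G2[OF s] G3[OF s])
  qed (simp_all add: Zs)
  \<comment> \<open>Bounces and glides contribute the same total, by summation by parts; this
    absorbs the factor \<open>1/2\<close> in the action.\<close>
  have "(\<Sum>k<6. (- Jsymp (Z (Suc k) - Z k)) \<bullet> Z k) = 2 * ((b - a) \<bullet> p1 + (c - b) \<bullet> p2 + (a - c) \<bullet> p3)"
    unfolding Z_def by (simp add: eval_nat_numeral Jsymp_def inner_diff_left inner_diff_right inner_commute)
  then show thesis using z that by simp
qed

text \<open>Multiplier argument: triples on the level \<open>H\<close> of the separating functional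
  miss the interior of \<open>K\<close>, hence are at least as long as the minimiser, which lies on
  that level.\<close>

lemma minimal_loop_gen_char:
  assumes Q: "convex_polygon Q" and K: "convex_shape K" and miss: "misses K a b c"
    and min: "\<And>x y w. misses K x y w \<Longrightarrow> loop_qlength Q a b c \<le> loop_qlength Q x y w"
  obtains T z z' where "closed_gen_char (K \<times> Q) T z z'" "action T z z' = loop_qlength Q a b c"
proof -
  note Qp = convex_polygonD[OF Q]
  have Kp: "convex K" "interior K \<noteq> {}" using K unfolding convex_shape_def by auto
  define l where "l = loop_qlength Q a b c"
  have l: "0 < l" unfolding l_def using misses_loop_qlength_pos(1)[OF Q K miss] .
  obtain m1 m2 m3 where m: "m1 + m2 + m3 = 0" "(m1, m2, m3) \<noteq> 0"
    "\<And>x y w. \<lbrakk>x \<in> K; y \<in> K; w \<in> K\<rbrakk> \<Longrightarrow> m1 \<bullet> x + m2 \<bullet> y + m3 \<bullet> w \<le> m1 \<bullet> a + m2 \<bullet> b + m3 \<bullet> c"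
    by (rule misses_separation[OF K miss]) (rule that)
  define H where "H = m1 \<bullet> a + m2 \<bullet> b + m3 \<bullet> c"
  \<comment> \<open>Otherwise the same functional would certify that a single point misses the
    interior of \<open>K\<close>.\<close>
  have H: "0 < H"
  proof (rule ccontr)
    assume "\<not> 0 < H"
    have "misses K 0 0 0"
    proof (rule misses_criterion[OF m(1,2)])
      fix x y w assume "x \<in> K" "y \<in> K" "w \<in> K"
      from m(3)[OF this] show "m1 \<bullet> x + m2 \<bullet> y + m3 \<bullet> w \<le> m1 \<bullet> 0 + m2 \<bullet> 0 + m3 \<bullet> 0"
        using \<open>\<not> 0 < H\<close> unfolding H_def by simp
    qed
    then show False using misses_loop_qlength_pos(2)[OF Q K] by blast
  qed
  \<comment> \<open>The factor that makes functional and length agree at \<open>a\<close>,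
    \<open>b\<close>, \<open>c\<close>.\<close>
  define \<mu> where "\<mu> = l / H"
  have \<mu>: "0 < \<mu>" unfolding \<mu>_def using l H by simp
  \<comment> \<open>A triple with positive value \<open>s\<close> is rescaled to the level
    \<open>H\<close> and compared with the minimum; for \<open>s \<le> 0\<close> nonnegativity of
    the length is enough.\<close>
  have dom: "(\<mu> *\<^sub>R m1) \<bullet> x + (\<mu> *\<^sub>R m2) \<bullet> y + (\<mu> *\<^sub>R m3) \<bullet> w \<le> loop_qlength Q x y w" for x y w
  proof -
    define s where "s = m1 \<bullet> x + m2 \<bullet> y + m3 \<bullet> w"
    have eq: "(\<mu> *\<^sub>R m1) \<bullet> x + (\<mu> *\<^sub>R m2) \<bullet> y + (\<mu> *\<^sub>R m3) \<bullet> w = \<mu> * s"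
      unfolding s_def by (simp add: algebra_simps)
    show ?thesis
    proof (cases "0 < s")
      case True
      define r where "r = H / s"
      have r: "0 < r" unfolding r_def using True H by simp
      have "m1 \<bullet> (r *\<^sub>R x) + m2 \<bullet> (r *\<^sub>R y) + m3 \<bullet> (r *\<^sub>R w) = r * s"
        unfolding s_def by (simp add: algebra_simps)
      also have "r * s = H" unfolding r_def using True by simp
      finally have "misses K (r *\<^sub>R x) (r *\<^sub>R y) (r *\<^sub>R w)"
        using m(3) by (intro misses_criterion[OF m(1,2)]) (simp add: H_def)
      then have "l \<le> r * loop_qlength Q x y w"
        using min loop_qlength_scaleR[OF Qp(2,4), of r x y w] r unfolding l_def by fastforce
      then have "l * s \<le> H * loop_qlength Q x y w" unfolding r_def using True by (simp add: field_simps)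
      then show ?thesis unfolding eq unfolding \<mu>_def using H by (simp add: field_simps)
    next
      case False
      obtain y0 r where r: "0 < r" "cball y0 r \<subseteq> Q" using interior_cballE Qp(5) by blast
      have "0 \<le> r * (norm (y - x) + norm (w - y) + norm (x - w))" using r by simp
      also have "\<dots> \<le> loop_qlength Q x y w" using r by (intro loop_qlength_ge[OF Qp(2)]) auto
      finally show ?thesis unfolding eq using False \<mu> by (meson mult_nonneg_nonpos less_imp_le not_less order_trans)
    qed
  qed
  obtain p1 p2 p3 where p: "p1 \<in> Q" "p2 \<in> Q" "p3 \<in> Q"
      and mp: "\<mu> *\<^sub>R m1 = p3 - p1" "\<mu> *\<^sub>R m2 = p1 - p2" "\<mu> *\<^sub>R m3 = p2 - p3"
    by (rule loop_qlength_dominated[OF Qp(2,3,4) dom]) (rule that)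
  have "(\<mu> *\<^sub>R m1) \<bullet> a + (\<mu> *\<^sub>R m2) \<bullet> b + (\<mu> *\<^sub>R m3) \<bullet> c = \<mu> * H"
    unfolding H_def by (simp add: algebra_simps)
  also have "\<dots> = l" unfolding \<mu>_def using H by simp
  finally have tot: "(b - a) \<bullet> p1 + (c - b) \<bullet> p2 + (a - c) \<bullet> p3 = l"
    unfolding mp by (simp add: inner_diff_left inner_diff_right inner_commute)
  have "(b - a) \<bullet> p1 \<le> qnorm Q (b - a)" "(c - b) \<bullet> p2 \<le> qnorm Q (c - b)" "(a - c) \<bullet> p3 \<le> qnorm Q (a - c)"
    using inner_le_qnorm[OF Qp(2)] p by auto
  \<comment> \<open>Three upper bounds whose sum is attained are attained one by one.\<close>
  then have h: "qnorm Q (b - a) = (b - a) \<bullet> p1" "qnorm Q (c - b) = (c - b) \<bullet> p2" "qnorm Q (a - c) = (a - c) \<bullet> p3"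
    using tot unfolding l_def loop_qlength_def by linarith+
  obtain t where t: "a + t \<in> K" "b + t \<in> K" "c + t \<in> K"
    using minimal_loop_fits[OF Q K miss min] by blast
  have mt: "m1 \<bullet> t + m2 \<bullet> t + m3 \<bullet> t = 0" using m(1) by (metis inner_add_left inner_zero_left)
  \<comment> \<open>Varying one vertex over \<open>K\<close> with the other two kept in place turns
    the joint bound into three separate normal conditions.\<close>
  have nrm: "m1 \<bullet> y \<le> m1 \<bullet> (a + t)" "m2 \<bullet> y \<le> m2 \<bullet> (b + t)" "m3 \<bullet> y \<le> m3 \<bullet> (c + t)" if y: "y \<in> K" for y
    using m(3)[OF y t(2,3)] m(3)[OF t(1) y t(3)] m(3)[OF t(1,2) y] mt by (simp_all add: inner_add_right)
  have nrm': "(p3 - p1) \<bullet> y \<le> (p3 - p1) \<bullet> (a + t)" "(p1 - p2) \<bullet> y \<le> (p1 - p2) \<bullet> (b + t)"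
      "(p2 - p3) \<bullet> y \<le> (p2 - p3) \<bullet> (c + t)" if y: "y \<in> K" for y
    unfolding mp[symmetric] using nrm[OF y] \<mu> by simp_all
  have d: "(b + t) - (a + t) = b - a" "(c + t) - (b + t) = c - b" "(a + t) - (c + t) = a - c" by auto
  have v: "(b - a) \<bullet> y \<le> (b - a) \<bullet> p1" "(c - b) \<bullet> y \<le> (c - b) \<bullet> p2" "(a - c) \<bullet> y \<le> (a - c) \<bullet> p3"
    if "y \<in> Q" for y
    using inner_le_qnorm[OF Qp(2) that] h by metis+
  obtain T z z' where "closed_gen_char (K \<times> Q) T z z'"
    "action T z z' = (b + t - (a + t)) \<bullet> p1 + (c + t - (b + t)) \<bullet> p2 + (a + t - (c + t)) \<bullet> p3"
  proof (rule closed_billiard_gen_char[OF Kp(1) t Qp(3) p nrm'])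
    show "\<not> (a + t = b + t \<and> b + t = c + t)" using misses_loop_qlength_pos(2)[OF Q K miss] by simp
  qed (simp_all only: d v)
  then show thesis using that tot unfolding d l_def by simp
qed

lemma fits_convex_hullI:
  assumes "convex K" "\<And>x. x \<in> S \<Longrightarrow> x + t \<in> K"
  shows "fits (convex hull S) K"
proof -
  have "convex ((\<lambda>x. - t + x) ` K)" using assms(1) by (rule convex_translation)
  moreover have "S \<subseteq> (\<lambda>x. - t + x) ` K"
  proof
    fix x assume "x \<in> S"
    then show "x \<in> (\<lambda>x. - t + x) ` K" using assms(2) by (intro image_eqI[of _ _ "x + t"]) auto
  qed
  ultimately have "convex hull S \<subseteq> (\<lambda>x. - t + x) ` K" by (rule hull_minimal[rotated])
  then show ?thesis unfolding fits_def by (intro exI[of _ t]) auto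
qed

lemma Q_normal_triangle_not_fits:
  assumes Q: "Q \<noteq> {}" and K: "convex K" and T: "Q_normal_triangle Q T" "\<not> fits T K"
  obtains a b c where "loop_qlength Q a b c = 1" "\<nexists>t. a + t \<in> K \<and> b + t \<in> K \<and> c + t \<in> K"
proof -
  consider u v w where "T = convex hull {u, v, w}" "qnorm Q (v - u) + qnorm Q (w - v) + qnorm Q (u - w) = 1"
    | u v where "T = closed_segment u v" "qnorm Q (v - u) + qnorm Q (u - v) = 1"
    using T(1) unfolding Q_normal_triangle_def by blast
  then show thesis
  proof cases
    case 1
    show thesis
    proof (rule that[of u v w])
      show "loop_qlength Q u v w = 1" using 1 unfolding loop_qlength_def by simp
      show "\<nexists>t. u + t \<in> K \<and> v + t \<in> K \<and> w + t \<in> K"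
        using fits_convex_hullI[OF K, of "{u, v, w}"] T(2) 1(1) by auto
    qed
  next
    case 2
    show thesis
    \<comment> \<open>The segment becomes a triple with repeated vertex \<open>v\<close>; the extra
      edge has length 0.\<close>
    proof (rule that[of u v v])
      show "loop_qlength Q u v v = 1" using 2 qnorm_0[OF Q] unfolding loop_qlength_def by simp
      show "\<nexists>t. u + t \<in> K \<and> v + t \<in> K \<and> v + t \<in> K"
        using fits_convex_hullI[OF K, of "{u, v}"] T(2) 2(1) by (auto simp: segment_convex_hull)
    qed
  qed
qed

text \<open>A segment longer than twice a norm bound for \<open>K\<close>. It starts the
  minimisation that yields a characteristic, so the capacity is not the uninformative
  \<open>Inf\<close> of the empty set.\<close>

lemma misses_exists:
  assumes "bounded K"
  obtains b where "misses K 0 b 0"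
proof -
  obtain B where B: "\<And>x. x \<in> K \<Longrightarrow> norm x \<le> B" using assms bounded_iff by blast
  define b :: R2 where "b = (2 * \<bar>B\<bar> + 1) *\<^sub>R axis 1 1"
  have nb: "norm b = 2 * \<bar>B\<bar> + 1" unfolding b_def by (simp add: norm_axis_1)
  have "misses K 0 b 0" unfolding misses_def
  proof (intro allI notI)
    fix t assume "0 + t \<in> interior K \<and> b + t \<in> interior K \<and> 0 + t \<in> interior K"
    then have "norm t \<le> B" "norm (b + t) \<le> B" using B interior_subset by auto
    moreover have "norm b \<le> norm (b + t) + norm t" using norm_triangle_ineq4[of "b + t" t] by simp
    ultimately show False using nb by linarith
  qed
  then show thesis by (rule that)
qed

lemma EHZ_capacity_ge_1_iff:
  assumes Q: "convex_polygon Q" and K: "convex_shape K"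
  shows "(\<forall>T. Q_normal_triangle Q T \<longrightarrow> fits T K) \<longleftrightarrow> EHZ_capacity (K \<times> Q) \<ge> 1"
proof
  note Qp = convex_polygonD[OF Q]
  have Kp: "bounded K" "convex K" using K compact_imp_bounded unfolding convex_shape_def by auto
  let ?A = "{action T z z' | T z z'. closed_gen_char (K \<times> Q) T z z'}"
  {
    assume fit: "\<forall>T. Q_normal_triangle Q T \<longrightarrow> fits T K"
    obtain b0 where m0: "misses K 0 b0 0" by (rule misses_exists[OF Kp(1)])
    obtain b c where bc: "misses K 0 b c" "\<And>x y w. misses K x y w \<Longrightarrow> loop_qlength Q 0 b c \<le> loop_qlength Q x y w"
      by (rule minimal_loop[OF Q m0]) (rule that)
    obtain T z z' where "closed_gen_char (K \<times> Q) T z z'" by (rule minimal_loop_gen_char[OF Q K bc]) (assumption, rule that)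
    then have "?A \<noteq> {}" by blast
    moreover have "1 \<le> x" if "x \<in> ?A" for x
      using that action_lower_bound(2)[OF Q K] fit by blast
    ultimately show "EHZ_capacity (K \<times> Q) \<ge> 1"
      unfolding EHZ_capacity_def by (rule cInf_greatest)
  }
  assume cap: "EHZ_capacity (K \<times> Q) \<ge> 1"
  show "\<forall>T. Q_normal_triangle Q T \<longrightarrow> fits T K"
  proof (intro allI impI, rule ccontr)
    fix T assume T: "Q_normal_triangle Q T" "\<not> fits T K"
    obtain x y w where xyw: "loop_qlength Q x y w = 1" "\<nexists>t. x + t \<in> K \<and> y + t \<in> K \<and> w + t \<in> K"
      by (rule Q_normal_triangle_not_fits[OF Qp(4) Kp(2) T]) (rule that)
    then have m: "misses K x y w" unfolding misses_def using interior_subset by blast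
    obtain b c where bc: "misses K 0 b c" "\<And>x y w. misses K x y w \<Longrightarrow> loop_qlength Q 0 b c \<le> loop_qlength Q x y w"
      by (rule minimal_loop[OF Q m]) (rule that)
    have "loop_qlength Q 0 b c \<le> 1" using bc(2)[OF m] xyw(1) by simp
    \<comment> \<open>At minimal length exactly 1 the triple \<open>x\<close>, \<open>y\<close>,
      \<open>w\<close> would itself be a minimiser and hence fit into \<open>K\<close>. The strict
      inequality is what contradicts the capacity bound.\<close>
    moreover have "loop_qlength Q 0 b c \<noteq> 1"
    proof
      assume "loop_qlength Q 0 b c = 1"
      then have "\<exists>t. x + t \<in> K \<and> y + t \<in> K \<and> w + t \<in> K"
        using bc(2) xyw(1) by (intro minimal_loop_fits[OF Q K m]) simp
      then show False using xyw(2) by blast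
    qed
    ultimately have l: "loop_qlength Q 0 b c < 1" by simp
    obtain T z z' where ch: "closed_gen_char (K \<times> Q) T z z'" "action T z z' = loop_qlength Q 0 b c"
      by (rule minimal_loop_gen_char[OF Q K bc]) (assumption, rule that)
    have "bdd_below ?A" using action_lower_bound(1)[OF Q K] by (intro bdd_belowI[of _ 0]) blast
    then have "EHZ_capacity (K \<times> Q) \<le> action T z z'"
      unfolding EHZ_capacity_def using ch(1) by (intro cInf_lower) blast
    then show False using cap ch(2) l by simp
  qed
qed

theorem theorem3p3:
  fixes Q K :: "(real^2) set"
  assumes "convex_polygon Q" and "convex_shape K"
  shows "((\<forall>T. Q_normal_triangle Q T \<longrightarrow> fits T K) \<longrightarrow>
            (\<forall>\<gamma>. closed_curve \<gamma> \<and> unit_qlength Q \<gamma> \<longrightarrow> fits (\<gamma> ` {0..1}) K))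
       \<and> ((\<forall>T. Q_normal_triangle Q T \<longrightarrow> fits T K) \<longleftrightarrow> EHZ_capacity (K \<times> Q) \<ge> 1)"
  using unit_curve_fits[OF assms] EHZ_capacity_ge_1_iff[OF assms] by blast

end
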